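(* For $0<p\le2$, let $0<\alpha<\min(1,p)$ when $0<p<2$ and $0<\alpha<1$ when $p=2$. Suppose that $f$ is the solution of the Cauchy problem for $\frac{\partial f}{\partial t}+\Lambda^pf=0$ on $\mathbb{R}^d\times(0,\infty)$ with initial datum $\mu\in\mathcal{P}_\alpha(\mathbb{R}^d)$, and let $df_t(x)=f(x,t)\,dx$ for each $t>0$, $f_0=\mu$. Then $$\rho_\alpha(f_t,\mu)\le\left[\frac{2\pi^{d/2}\,\Gamma(1-\alpha/p)}{\alpha\,\Gamma(d/2)}\right]t^{\alpha/p}\,\|\widehat\mu\|_\infty$$ for each $t\ge0$. As a consequence, $f_t\to\mu$ as $t\to0+$ in the sense $$\lim_{t\to0+}\rho_\alpha(f_t,\mu)=0 .$$
   Context: Let $d\ge1$ and let $|\cdot|$ denote the Euclidean norm on $\mathbb{R}^d$. $\mathcal{P}(\mathbb{R}^d)$ is the set of Borel probability measures on $\mathbb{R}^d$ and $\mathcal{P}_\alpha(\mathbb{R}^d)=\{\mu\in\mathcal{P}(\mathbb{R}^d):\int|v|^\alpha d\mu(v)<\infty\}$. The Fourier transform of $\mu$ is $\widehat\mu(\xi)=\int_{\mathbb{R}^d}e^{-i\xi\cdot v}d\mu(v)$, and $\|\widehat\mu\|_\infty=\sup_\xi|\widehat\mu(\xi)|$. $\Lambda^p$ is the operator with $(\Lambda^pg)^{\wedge}(\xi)=|\xi|^p\widehat g(\xi)$. The solution of the Cauchy problem with initial datum $\mu$ means the function $$f(x,t)=\int_{\mathbb{R}^d}E_p(x-y,t)\,d\mu(y)\quad(x\in\mathbb{R}^d,\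 t>0),$$ where $E_p(x,t)=t^{-d/p}E_p(t^{-1/p}x)$ and $E_p(v)=(2\pi)^{-d}\int_{\mathbb{R}^d}e^{iv\cdot\xi-|\xi|^p}d\xi$; equivalently, $\widehat{f_t}(\xi)=e^{-t|\xi|^p}\widehat\mu(\xi)$. For probability measures $\mu,\nu$, $$\rho_\alpha(\mu,\nu)=\int_{\mathbb{R}^d}\frac{|\widehat\mu(\xi)-\widehat\nu(\xi)|}{|\xi|^{d+\alpha}}\,d\xi .$$ *)

theory Defs
  imports "HOL-Probability.Probability"
begin

definition borel_probs :: "(real ^ 'n) measure set" where
  "borel_probs = {\<mu>. prob_space \<mu> \<and> sets \<mu> = sets borel}"

definition borel_probs_moment :: "real \<Rightarrow> (real ^ 'n) measure set" where
  "borel_probs_moment \<alpha> = {\<mu> \<in> borel_probs. integrable \<mu> (\<lambda>v. norm v powr \<alpha>)}"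

text \<open>Note the sign in the exponent: \<^const>\<open>char\<close> of the library uses the opposite one
  (and is restricted to dimension one).\<close>

definition fourier :: "(real ^ 'n) measure \<Rightarrow> real ^ 'n \<Rightarrow> complex" where
  "fourier \<mu> \<xi> = (LINT v|\<mu>. exp (- (\<i> * complex_of_real (\<xi> \<bullet> v))))"

definition sup_norm :: "(real ^ 'n \<Rightarrow> complex) \<Rightarrow> real" where
  "sup_norm g = (SUP \<xi>. cmod (g \<xi>))"

text \<open>The integral below is real, since reflecting \<open>\<xi>\<close> conjugates the integrand; taking the real
  part only serves to obtain a real-valued kernel.\<close>

definition kernel_profile :: "real \<Rightarrow> real ^ 'n \<Rightarrow> real" where
  "kernel_profile p v = (2 * pi) powr (- real CARD('n)) *
     Re (LINT \<xi>|lborel. exp (\<i> * complex_of_real (v \<bullet> \<xi>) - complex_of_real (norm \<xi> powr p)))"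

definition heat_kernel :: "real \<Rightarrow> real ^ 'n \<Rightarrow> real \<Rightarrow> real" where
  "heat_kernel p x t =
     t powr (- real CARD('n) / p) * kernel_profile p (t powr (- 1 / p) *\<^sub>R x)"

definition cauchy_solution :: "real \<Rightarrow> (real ^ 'n) measure \<Rightarrow> real ^ 'n \<Rightarrow> real \<Rightarrow> real" where
  "cauchy_solution p \<mu> x t = (LINT y|\<mu>. heat_kernel p (x - y) t)"

text \<open>The measures \<open>f\<^sub>t\<close>, with \<open>f\<^sub>0 = \<mu>\<close>. The coercion to \<^typ>\<open>ennreal\<close> loses nothing for
  \<open>0 < p \<le> 2\<close>, where the kernel is nonnegative; negative times are not meaningful.\<close>

definition time_slice ::
    "(real ^ 'n \<Rightarrow> real \<Rightarrow> real) \<Rightarrow> (real ^ 'n) measure \<Rightarrow> real \<Rightarrow> (real ^ 'n) measure" where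
  "time_slice f \<mu> t = (if t = 0 then \<mu> else density lborel (\<lambda>x. ennreal (f x t)))"

text \<open>The distance is an extended nonnegative real, so that a divergent integral has value
  \<open>\<infinity>\<close>, and an upper bound by a real number includes finiteness.\<close>

definition rho :: "real \<Rightarrow> (real ^ 'n) measure \<Rightarrow> (real ^ 'n) measure \<Rightarrow> ennreal" where
  "rho \<alpha> \<mu> \<nu> = (\<integral>\<^sup>+ \<xi>. ennreal
     (cmod (fourier \<mu> \<xi> - fourier \<nu> \<xi>) / norm \<xi> powr (real CARD('n) + \<alpha>)) \<partial>lborel)"

end

theory Submission
  imports Defs "HOL-Real_Asymp.Real_Asymp"
begin

text \<open>
  On the Fourier side the equation is solved by damping: the transform of \<open>f\<^sub>t\<close> is
  \<open>exp (- t \<bar>\<xi>\<bar>\<^sup>p)\<close> times that of \<open>\<mu>\<close>. The numerator in \<open>\<rho>\<^sub>\<alpha>(f\<^sub>t, \<mu>)\<close> is therefore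
  \<open>(1 - exp (- t \<bar>\<xi>\<bar>\<^sup>p)) \<bar>\<mu>^(\<xi>)\<bar>\<close>, and after bounding the transform of \<open>\<mu>\<close> by its supremum only
  the integral of \<open>(1 - exp (- t \<bar>\<xi>\<bar>\<^sup>p)) / \<bar>\<xi>\<bar> powr (d + \<alpha>)\<close> is left. In polar coordinates with the
  radial variable \<open>s = t \<bar>\<xi>\<bar>\<^sup>p\<close> this is a constant times
  \<open>t powr (\<alpha> / p)\<close> times the integral of \<open>(1 - exp (- s)) s powr (- \<alpha> / p - 1)\<close>, whose value is
  \<open>Gamma (1 - \<alpha> / p) p / \<alpha>\<close>. The exponent \<open>\<alpha> / p\<close> of \<open>t\<close> is positive, which gives the limit.

  The damping formula is where the work lies. The measure \<open>f\<^sub>t\<close> is built from the kernel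
  by an inverse Fourier integral, so it has to be shown that the kernel is nonnegative, that it is
  integrable, and that its transform is \<open>exp (- t \<bar>\<xi>\<bar>\<^sup>p)\<close>.

  Nonnegativity holds because \<open>exp (- \<bar>\<xi>\<bar>\<^sup>p)\<close> is a limit of positive mixtures of Gaussians in \<open>\<xi>\<close>
  when \<open>p \<le> 2\<close>. Put \<open>b = p / 2\<close> and \<open>\<lambda> = \<bar>\<xi>\<bar>\<^sup>2\<close>. For \<open>0 < b \<le> 1\<close> all coefficients
  but the constant one of the binomial series of \<open>(1 - x) powr b\<close> are nonpositive. Inserting
  \<open>x = r exp (- \<lambda> / n)\<close> exhibits \<open>1 - (1 - x) powr b\<close>, and hence its powers and exponentials, as a
  positive combination of Gaussians; and \<open>n powr b (1 - x) powr b\<close> tends to \<open>\<lambda> powr b\<close> when \<open>r\<close>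
  tends to one fast enough. This is \<open>gauss_pos_exp_neg_powr\<close>. Integrability and the transform of
  the kernel then follow from Fourier inversion for integrable functions with nonnegative
  transform, \<open>fourier_inversion_nonneg\<close>.
\<close>

section \<open>The Fourier transform of a Gaussian\<close>

lemma borel_measurable_cis [measurable]: "cis \<in> borel_measurable borel"
  by (intro borel_measurable_continuous_onI continuous_on_cis continuous_on_id)

lemma gaussian_fourier_real:
  fixes s u :: real
  assumes s: "0 < s"
  shows "integrable lborel (\<lambda>x. exp (- (s / 2) * x\<^sup>2) *\<^sub>R cis (u * x))"
    and "(\<integral>x. exp (- (s / 2) * x\<^sup>2) *\<^sub>R cis (u * x) \<partial>lborel)
      = of_real (sqrt (2 * pi / s) * exp (- u\<^sup>2 / (2 * s)))"
proof -
  define w where "w = u / sqrt s"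
  have w: "w * sqrt s = u" "w\<^sup>2 = u\<^sup>2 / s"
    using s by (auto simp: w_def power_divide)
  have std: "exp (- x\<^sup>2 / 2) *\<^sub>R cis (w * x) = sqrt (2 * pi) *\<^sub>R (std_normal_density x *\<^sub>R cis (w * x))" for x
    by (simp add: std_normal_density_def)
  have int: "integrable lborel (\<lambda>x. std_normal_density x *\<^sub>R cis (w * x))"
    by (rule Bochner_Integration.integrable_bound[OF integrable_normal_density[of 1 0]]) auto
  then have intw: "integrable lborel (\<lambda>x. exp (- x\<^sup>2 / 2) *\<^sub>R cis (w * x))"
    unfolding std by (rule integrable_scaleR_right)
  have "(\<integral>x. std_normal_density x *\<^sub>R cis (w * x) \<partial>lborel) = char std_normal_distribution w"
    unfolding char_def by (subst integral_density) (auto simp: cis_conv_exp)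
  then have val: "(\<integral>x. exp (- x\<^sup>2 / 2) *\<^sub>R cis (w * x) \<partial>lborel)
      = of_real (sqrt (2 * pi) * exp (- w\<^sup>2 / 2))"
    unfolding std using int by (simp add: char_std_normal_distribution scaleR_conv_of_real)
  have sub: "exp (- (0 + sqrt s * x)\<^sup>2 / 2) *\<^sub>R cis (w * (0 + sqrt s * x))
      = exp (- (s / 2) * x\<^sup>2) *\<^sub>R cis (u * x)" for x
    using s by (simp add: power_mult_distrib mult.assoc[symmetric] w)
  show "integrable lborel (\<lambda>x. exp (- (s / 2) * x\<^sup>2) *\<^sub>R cis (u * x))"
    using lborel_integrable_real_affine[OF intw, of "sqrt s" 0] s unfolding sub by simp
  have "of_real (sqrt (2 * pi) * exp (- w\<^sup>2 / 2))
      = sqrt s *\<^sub>R (\<integral>x. exp (- (s / 2) * x\<^sup>2) *\<^sub>R cis (u * x) \<partial>lborel)"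
    using lborel_integral_real_affine[of "sqrt s" "\<lambda>x. exp (- x\<^sup>2 / 2) *\<^sub>R cis (w * x)" 0] s
    unfolding sub val by simp
  then show "(\<integral>x. exp (- (s / 2) * x\<^sup>2) *\<^sub>R cis (u * x) \<partial>lborel)
      = of_real (sqrt (2 * pi / s) * exp (- u\<^sup>2 / (2 * s)))"
    using s by (simp add: w scaleR_conv_of_real field_simps real_sqrt_divide)
qed

text \<open>
  Both the Gaussian and the character factor over the coordinates, so the integral is a product
  of one-dimensional ones.
\<close>

lemma gaussian_fourier:
  fixes v :: "'a::euclidean_space" and s :: real
  assumes s: "0 < s"
  shows "integrable lborel (\<lambda>\<xi>::'a. exp (- (s / 2) * (norm \<xi>)\<^sup>2) *\<^sub>R cis (v \<bullet> \<xi>))"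
    and "(\<integral>\<xi>. exp (- (s / 2) * (norm \<xi>)\<^sup>2) *\<^sub>R cis (v \<bullet> \<xi>) \<partial>lborel)
      = of_real ((2 * pi / s) powr (DIM('a) / 2) * exp (- (norm v)\<^sup>2 / (2 * s)))"
proof -
  let ?f = "\<lambda>b x. exp (- (s / 2) * x\<^sup>2) *\<^sub>R cis ((v \<bullet> b) * x)"
  interpret product_sigma_finite "\<lambda>_::'a. lborel :: real measure"
    by unfold_locales
  have cis_sum: "cis (\<Sum>b\<in>A. h b) = (\<Prod>b\<in>A. cis (h b))" if "finite A" for h :: "'a \<Rightarrow> real" and A
    using that by induction (auto simp: cis_mult[symmetric])
  have split: "exp (- (s / 2) * (norm (\<Sum>b\<in>Basis. x b *\<^sub>R b))\<^sup>2) *\<^sub>R cis (v \<bullet> (\<Sum>b\<in>Basis. x b *\<^sub>R b))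
      = (\<Prod>b\<in>Basis. ?f b (x b))" for x :: "'a \<Rightarrow> real"
  proof -
    have "(norm (\<Sum>b\<in>Basis. x b *\<^sub>R b))\<^sup>2 = (\<Sum>b\<in>Basis. (x b)\<^sup>2)"
      unfolding power2_norm_eq_inner
      by (subst euclidean_inner) (simp add: inner_sum_left_Basis power2_eq_square)
    moreover have "v \<bullet> (\<Sum>b\<in>Basis. x b *\<^sub>R b) = (\<Sum>b\<in>Basis. (v \<bullet> b) * x b)"
      by (simp add: inner_sum_right mult.commute)
    ultimately show ?thesis
      by (simp add: sum_distrib_left exp_sum cis_sum scaleR_conv_of_real prod.distrib sum_negf[symmetric] del: sum_negf)
  qed
  have [measurable]: "(\<lambda>f. \<Sum>b\<in>Basis. f b *\<^sub>R b :: 'a) \<in> measurable (\<Pi>\<^sub>M b\<in>Basis. lborel) borel"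
    by measurable
  have int: "integrable (\<Pi>\<^sub>M b\<in>(Basis::'a set). lborel) (\<lambda>x. \<Prod>b\<in>Basis. ?f b (x b))"
    by (rule product_integrable_prod[OF finite_Basis gaussian_fourier_real(1)[OF s]])
  show "integrable lborel (\<lambda>\<xi>::'a. exp (- (s / 2) * (norm \<xi>)\<^sup>2) *\<^sub>R cis (v \<bullet> \<xi>))"
    unfolding lborel_eq[where 'a='a] 
    by (subst integrable_distr_eq) (measurable, simp only: split int)
  have "(\<integral>\<xi>. exp (- (s / 2) * (norm \<xi>)\<^sup>2) *\<^sub>R cis (v \<bullet> \<xi>) \<partial>lborel)
    = (\<integral>x. (\<Prod>b\<in>Basis. ?f b (x b)) \<partial>(\<Pi>\<^sub>M b\<in>(Basis::'a set). lborel))"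
    unfolding lborel_eq[where 'a='a] 
    by (subst integral_distr) (measurable, simp only: split)
  also have "\<dots> = (\<Prod>b\<in>(Basis::'a set). of_real (sqrt (2 * pi / s) * exp (- (v \<bullet> b)\<^sup>2 / (2 * s))))"
    unfolding product_integral_prod[OF finite_Basis gaussian_fourier_real(1)[OF s]]
    by (simp only: gaussian_fourier_real(2)[OF s])
  also have "\<dots> = of_real (sqrt (2 * pi / s) ^ DIM('a) * exp (\<Sum>b\<in>(Basis::'a set). - (v \<bullet> b)\<^sup>2 / (2 * s)))"
    by (simp add: prod.distrib exp_sum)
  also have "(\<Sum>b\<in>(Basis::'a set). - (v \<bullet> b)\<^sup>2 / (2 * s)) = - (norm v)\<^sup>2 / (2 * s)"
    unfolding power2_norm_eq_inner euclidean_inner[of v v]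
    by (simp add: sum_divide_distrib sum_negf power2_eq_square)
  also have "sqrt (2 * pi / s) ^ DIM('a) = (2 * pi / s) powr (DIM('a) / 2)"
    using s by (simp add: powr_half_sqrt[symmetric] powr_realpow[symmetric] powr_powr)
  finally show "(\<integral>\<xi>. exp (- (s / 2) * (norm \<xi>)\<^sup>2) *\<^sub>R cis (v \<bullet> \<xi>) \<partial>lborel)
      = of_real ((2 * pi / s) powr (DIM('a) / 2) * exp (- (norm v)\<^sup>2 / (2 * s)))" .
qed

lemma integrable_gaussian:
  assumes s: "0 < s"
  shows "integrable lborel (\<lambda>\<xi>::'a::euclidean_space. exp (- (s / 2) * (norm \<xi>)\<^sup>2))"
  using gaussian_fourier(1)[OF s, of "0::'a"]
  by (rule integrable_norm[THEN iffD1[OF Bochner_Integration.integrable_cong, rotated 2]]) auto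

lemma integrable_bounded_gaussian:
  fixes h :: "'a::euclidean_space \<Rightarrow> real"
  assumes [measurable]: "h \<in> borel_measurable borel" and B: "\<And>\<xi>. \<bar>h \<xi>\<bar> \<le> B" and s: "0 < s"
  shows "integrable lborel (\<lambda>\<xi>. (h \<xi> * exp (- (s / 2) * (norm \<xi>)\<^sup>2)) *\<^sub>R cis (v \<bullet> \<xi>))"
proof (rule Bochner_Integration.integrable_bound)
  show "integrable lborel (\<lambda>\<xi>::'a. B * exp (- (s / 2) * (norm \<xi>)\<^sup>2))"
    by (intro integrable_mult_right integrable_gaussian s)
  have "0 \<le> B"
    using B[of 0] by linarith
  then show "AE \<xi> in lborel. norm ((h \<xi> * exp (- (s / 2) * (norm \<xi>)\<^sup>2)) *\<^sub>R cis (v \<bullet> \<xi>))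
      \<le> norm (B * exp (- (s / 2) * (norm \<xi>)\<^sup>2))"
    using B by (auto simp: abs_mult mult_right_mono)
qed measurable

section \<open>Positivity of the Fourier transform of a stretched exponential\<close>

text \<open>
  Positivity of the Fourier transform of a bounded function, which need not have one as an
  integral; this is why it is tested after multiplication with every Gaussian. The damping by a
  Gaussian is also what makes the notion stable under multiplication by Gaussians and under
  bounded pointwise limits. Membership in \<open>\<real>\<^sub>\<ge>\<^sub>0\<close> includes that the imaginary part vanishes.
\<close>

definition gauss_pos :: "('a::euclidean_space \<Rightarrow> real) \<Rightarrow> bool" where
  "gauss_pos h \<longleftrightarrow> h \<in> borel_measurable borel \<and> (\<exists>B. \<forall>\<xi>. \<bar>h \<xi>\<bar> \<le> B) \<and>
    (\<forall>s>0. \<forall>v. (\<integral>\<xi>. (h \<xi> * exp (- (s / 2) * (norm \<xi>)\<^sup>2)) *\<^sub>R cis (v \<bullet> \<xi>) \<partial>lborel) \<in> \<real>\<^sub>\<ge>\<^sub>0)"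

lemma gauss_posD:
  assumes "gauss_pos h"
  shows "h \<in> borel_measurable borel"
    and "0 < s \<Longrightarrow> integrable lborel (\<lambda>\<xi>. (h \<xi> * exp (- (s / 2) * (norm \<xi>)\<^sup>2)) *\<^sub>R cis (v \<bullet> \<xi>))"
    and "0 < s \<Longrightarrow> (\<integral>\<xi>. (h \<xi> * exp (- (s / 2) * (norm \<xi>)\<^sup>2)) *\<^sub>R cis (v \<bullet> \<xi>) \<partial>lborel) \<in> \<real>\<^sub>\<ge>\<^sub>0"
  using assms integrable_bounded_gaussian unfolding gauss_pos_def by blast+

lemma gauss_pos_one: "gauss_pos (\<lambda>_::'a::euclidean_space. 1)"
  using gaussian_fourier(2)[where 'a='a] by (auto simp: gauss_pos_def simp del: of_real_mult intro: exI[of _ 1])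

lemma gauss_pos_add:
  assumes f: "gauss_pos f" and g: "gauss_pos g"
  shows "gauss_pos (\<lambda>\<xi>. f \<xi> + g \<xi>)"
  unfolding gauss_pos_def
proof (intro conjI allI impI)
  show "(\<lambda>\<xi>. f \<xi> + g \<xi>) \<in> borel_measurable borel"
    using gauss_posD(1)[OF f] gauss_posD(1)[OF g] by measurable
  obtain A B where "\<And>\<xi>. \<bar>f \<xi>\<bar> \<le> A" "\<And>\<xi>. \<bar>g \<xi>\<bar> \<le> B"
    using f g unfolding gauss_pos_def by blast
  then show "\<exists>B. \<forall>\<xi>. \<bar>f \<xi> + g \<xi>\<bar> \<le> B"
    by (intro exI[of _ "A + B"]) (meson abs_triangle_ineq add_mono order_trans)
  show "(\<integral>\<xi>. ((f \<xi> + g \<xi>) * exp (- (s / 2) * (norm \<xi>)\<^sup>2)) *\<^sub>R cis (v \<bullet> \<xi>) \<partial>lborel) \<in> \<real>\<^sub>\<ge>\<^sub>0"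
    if "0 < s" for s v
    unfolding distrib_right scaleR_add_left
    using gauss_posD(2,3)[OF f that, of v] gauss_posD(2,3)[OF g that, of v]
    by (subst Bochner_Integration.integral_add) (auto intro: nonneg_Reals_add_I)
qed

lemma gauss_pos_cmult:
  assumes f: "gauss_pos f" and c: "0 \<le> c"
  shows "gauss_pos (\<lambda>\<xi>. c * f \<xi>)"
  unfolding gauss_pos_def
proof (intro conjI allI impI)
  show "(\<lambda>\<xi>. c * f \<xi>) \<in> borel_measurable borel"
    using gauss_posD(1)[OF f] by measurable
  obtain A where "\<And>\<xi>. \<bar>f \<xi>\<bar> \<le> A"
    using f unfolding gauss_pos_def by blast
  then show "\<exists>B. \<forall>\<xi>. \<bar>c * f \<xi>\<bar> \<le> B"
    using c by (intro exI[of _ "c * A"]) (auto simp: abs_mult intro: mult_left_mono)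
  show "(\<integral>\<xi>. ((c * f \<xi>) * exp (- (s / 2) * (norm \<xi>)\<^sup>2)) *\<^sub>R cis (v \<bullet> \<xi>) \<partial>lborel) \<in> \<real>\<^sub>\<ge>\<^sub>0"
    if "0 < s" for s v
  proof -
    have "(\<integral>\<xi>. ((c * f \<xi>) * exp (- (s / 2) * (norm \<xi>)\<^sup>2)) *\<^sub>R cis (v \<bullet> \<xi>) \<partial>lborel)
        = of_real c * (\<integral>\<xi>. (f \<xi> * exp (- (s / 2) * (norm \<xi>)\<^sup>2)) *\<^sub>R cis (v \<bullet> \<xi>) \<partial>lborel)"
      by (simp only: mult.assoc scaleR_scaleR[symmetric] integral_mult_right_zero scaleR_conv_of_real[of c])
    then show ?thesis
      using gauss_posD(3)[OF f that, of v] c by (simp only: nonneg_Reals_mult_I nonneg_Reals_of_real_iff)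
  qed
qed

lemma gauss_pos_sum:
  assumes "finite A" "\<And>k. k \<in> A \<Longrightarrow> gauss_pos (f k)"
  shows "gauss_pos (\<lambda>\<xi>. \<Sum>k\<in>A. f k \<xi>)"
  using assms
proof induction
  case empty
  show ?case
    using gauss_pos_cmult[OF gauss_pos_one, of 0] by simp
qed (auto intro: gauss_pos_add)

text \<open>
  Another Gaussian factor only changes the width of the Gaussian that is tested against.
\<close>

lemma gauss_pos_damp:
  assumes f: "gauss_pos f" and c: "0 \<le> c"
  shows "gauss_pos (\<lambda>\<xi>. f \<xi> * exp (- c * (norm \<xi>)\<^sup>2))"
  unfolding gauss_pos_def
proof (intro conjI allI impI)
  show "(\<lambda>\<xi>. f \<xi> * exp (- c * (norm \<xi>)\<^sup>2)) \<in> borel_measurable borel"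
    using gauss_posD(1)[OF f] by measurable
  obtain A where A: "\<And>\<xi>. \<bar>f \<xi>\<bar> \<le> A"
    using f unfolding gauss_pos_def by blast
  have "\<bar>f \<xi> * exp (- c * (norm \<xi>)\<^sup>2)\<bar> \<le> A * 1" for \<xi>
    unfolding abs_mult using A[of \<xi>] c by (intro mult_mono) auto
  then show "\<exists>B. \<forall>\<xi>. \<bar>f \<xi> * exp (- c * (norm \<xi>)\<^sup>2)\<bar> \<le> B"
    by blast
  show "(\<integral>\<xi>. ((f \<xi> * exp (- c * (norm \<xi>)\<^sup>2)) * exp (- (s / 2) * (norm \<xi>)\<^sup>2)) *\<^sub>R cis (v \<bullet> \<xi>) \<partial>lborel) \<in> \<real>\<^sub>\<ge>\<^sub>0"
    if s: "0 < s" for s v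
  proof -
    have "exp (- c * (norm \<xi>)\<^sup>2) * exp (- (s / 2) * (norm \<xi>)\<^sup>2) = exp (- ((s + 2 * c) / 2) * (norm \<xi>)\<^sup>2)" for \<xi> :: 'a
      by (simp add: exp_add[symmetric] field_simps)
    then show ?thesis
      unfolding mult.assoc using gauss_posD(3)[OF f, of "s + 2 * c" v] s c by simp
  qed
qed

lemma gauss_pos_limit:
  fixes f :: "nat \<Rightarrow> 'a::euclidean_space \<Rightarrow> real"
  assumes f: "\<And>n. gauss_pos (f n)" and B: "\<And>n \<xi>. \<bar>f n \<xi>\<bar> \<le> B"
    and lim: "\<And>\<xi>. (\<lambda>n. f n \<xi>) \<longlonglongrightarrow> g \<xi>"
  shows "gauss_pos g"
  unfolding gauss_pos_def
proof (intro conjI allI impI)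
  have [measurable]: "f n \<in> borel_measurable borel" for n
    using gauss_posD(1)[OF f] .
  show [measurable]: "g \<in> borel_measurable borel"
    by (rule borel_measurable_LIMSEQ_metric[OF _ lim]) measurable
  have "\<bar>g \<xi>\<bar> \<le> B" for \<xi>
    by (rule LIMSEQ_le_const2[OF tendsto_rabs[OF lim]]) (use B in auto)
  then show "\<exists>B. \<forall>\<xi>. \<bar>g \<xi>\<bar> \<le> B"
    by blast
  show "(\<integral>\<xi>. (g \<xi> * exp (- (s / 2) * (norm \<xi>)\<^sup>2)) *\<^sub>R cis (v \<bullet> \<xi>) \<partial>lborel) \<in> \<real>\<^sub>\<ge>\<^sub>0"
    if s: "0 < s" for s v
  proof (rule closed_sequentially[OF closed_nonneg_Reals_complex])
    show "(\<lambda>n. \<integral>\<xi>. (f n \<xi> * exp (- (s / 2) * (norm \<xi>)\<^sup>2)) *\<^sub>R cis (v \<bullet> \<xi>) \<partial>lborel)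
        \<longlonglongrightarrow> (\<integral>\<xi>. (g \<xi> * exp (- (s / 2) * (norm \<xi>)\<^sup>2)) *\<^sub>R cis (v \<bullet> \<xi>) \<partial>lborel)"
    proof (rule integral_dominated_convergence)
      show "integrable lborel (\<lambda>\<xi>::'a. B * exp (- (s / 2) * (norm \<xi>)\<^sup>2))"
        by (intro integrable_mult_right integrable_gaussian s)
      show "AE \<xi> in lborel. norm ((f n \<xi> * exp (- (s / 2) * (norm \<xi>)\<^sup>2)) *\<^sub>R cis (v \<bullet> \<xi>))
          \<le> B * exp (- (s / 2) * (norm \<xi>)\<^sup>2)" for n
        using B by (auto simp: abs_mult mult_right_mono)
      show "AE \<xi> in lborel. (\<lambda>n. (f n \<xi> * exp (- (s / 2) * (norm \<xi>)\<^sup>2)) *\<^sub>R cis (v \<bullet> \<xi>))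
          \<longlonglongrightarrow> (g \<xi> * exp (- (s / 2) * (norm \<xi>)\<^sup>2)) *\<^sub>R cis (v \<bullet> \<xi>)"
        by (intro AE_I2 tendsto_intros lim)
    qed measurable
  qed (use gauss_posD(3)[OF f s] in auto)
qed

text \<open>
  Every power of \<open>r exp (- a \<bar>\<xi>\<bar>\<^sup>2)\<close> is again a positive multiple of a Gaussian, so the partial sums
  only combine Gaussian factors; they are dominated by the value of the series at \<open>r\<close>.
\<close>

lemma gauss_pos_power_series:
  fixes f :: "'a::euclidean_space \<Rightarrow> real"
  assumes f: "gauss_pos f" and c: "\<And>k. 0 \<le> c k" and r: "0 \<le> r" and a: "0 \<le> a"
    and sm: "summable (\<lambda>k. c k * r ^ k)"
  shows "gauss_pos (\<lambda>\<xi>. f \<xi> * (\<Sum>k. c k * (r * exp (- a * (norm \<xi>)\<^sup>2)) ^ k))"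
proof -
  let ?x = "\<lambda>\<xi>::'a. r * exp (- a * (norm \<xi>)\<^sup>2)"
  obtain B where B: "\<And>\<xi>. \<bar>f \<xi>\<bar> \<le> B"
    using f unfolding gauss_pos_def by blast
  have x: "0 \<le> ?x \<xi>" "?x \<xi> \<le> r" for \<xi>
    using r a by (auto intro: mult_left_le)
  have le: "c k * ?x \<xi> ^ k \<le> c k * r ^ k" for k \<xi>
    using x c by (intro mult_left_mono power_mono) auto
  have smx: "summable (\<lambda>k. c k * ?x \<xi> ^ k)" for \<xi>
    by (rule summable_comparison_test'[OF sm, of 0]) (use x c le in \<open>auto simp: abs_mult\<close>)
  show ?thesis
  proof (rule gauss_pos_limit[where f="\<lambda>n \<xi>. f \<xi> * (\<Sum>k<n. c k * ?x \<xi> ^ k)"])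
    show "gauss_pos (\<lambda>\<xi>. f \<xi> * (\<Sum>k<n. c k * ?x \<xi> ^ k))" for n
    proof -
      have "gauss_pos (\<lambda>\<xi>. \<Sum>k<n. (c k * r ^ k) * (f \<xi> * exp (- (real k * a) * (norm \<xi>)\<^sup>2)))"
        using c r a by (intro gauss_pos_sum gauss_pos_cmult gauss_pos_damp f) auto
      also have "(\<lambda>\<xi>. \<Sum>k<n. (c k * r ^ k) * (f \<xi> * exp (- (real k * a) * (norm \<xi>)\<^sup>2)))
          = (\<lambda>\<xi>. f \<xi> * (\<Sum>k<n. c k * ?x \<xi> ^ k))"
        by (simp add: sum_distrib_left power_mult_distrib exp_of_nat_mult[symmetric] mult_ac)
      finally show ?thesis .
    qed
    show "\<bar>f \<xi> * (\<Sum>k<n. c k * ?x \<xi> ^ k)\<bar> \<le> B * (\<Sum>k. c k * r ^ k)" for n \<xi>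
    proof -
      have "(\<Sum>k<n. c k * ?x \<xi> ^ k) \<le> (\<Sum>k<n. c k * r ^ k)"
        by (intro sum_mono le)
      also have "\<dots> \<le> (\<Sum>k. c k * r ^ k)"
        using c r by (intro sum_le_suminf sm) auto
      finally have "(\<Sum>k<n. c k * ?x \<xi> ^ k) \<le> (\<Sum>k. c k * r ^ k)" .
      moreover have "0 \<le> (\<Sum>k<n. c k * ?x \<xi> ^ k)"
        using c x by (intro sum_nonneg mult_nonneg_nonneg) auto
      ultimately show ?thesis
        unfolding abs_mult using B[of \<xi>] by (intro mult_mono) auto
    qed
    show "(\<lambda>n. f \<xi> * (\<Sum>k<n. c k * ?x \<xi> ^ k)) \<longlonglongrightarrow> f \<xi> * (\<Sum>k. c k * ?x \<xi> ^ k)" for \<xi>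
      by (intro tendsto_mult tendsto_const summable_LIMSEQ smx)
  qed
qed

text \<open>
  The hypothesis is on multiplication by \<open>g\<close>, and not on \<open>g\<close> itself, because this is what can be
  iterated to reach all powers of \<open>g\<close>, and with them the partial sums of the exponential series.
\<close>

lemma gauss_pos_exp:
  fixes g :: "'a::euclidean_space \<Rightarrow> real"
  assumes mult: "\<And>f. gauss_pos f \<Longrightarrow> gauss_pos (\<lambda>\<xi>. f \<xi> * g \<xi>)"
    and bounds: "\<And>\<xi>. 0 \<le> g \<xi>" "\<And>\<xi>. g \<xi> \<le> B" and c: "0 \<le> c"
  shows "gauss_pos (\<lambda>\<xi>. exp (c * g \<xi>))"
proof (rule gauss_pos_limit[where f="\<lambda>n \<xi>. \<Sum>k<n. (c * g \<xi>) ^ k /\<^sub>R fact k"])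
  have pow: "gauss_pos (\<lambda>\<xi>. g \<xi> ^ k)" for k
    by (induction k) (auto simp: gauss_pos_one mult.commute[of "g _"] intro: mult)
  have "gauss_pos (\<lambda>\<xi>. \<Sum>k<n. (c ^ k / fact k) * g \<xi> ^ k)" for n
    using c by (intro gauss_pos_sum gauss_pos_cmult pow) auto
  then show "gauss_pos (\<lambda>\<xi>. \<Sum>k<n. (c * g \<xi>) ^ k /\<^sub>R fact k)" for n
    by (simp add: power_mult_distrib field_simps)
  show "\<bar>\<Sum>k<n. (c * g \<xi>) ^ k /\<^sub>R fact k\<bar> \<le> exp (c * B)" for n \<xi>
  proof -
    have "0 \<le> c * g \<xi>" "c * g \<xi> \<le> c * B"
      using bounds c by (auto intro: mult_left_mono)
    moreover have "0 \<le> (\<Sum>k<n. (c * g \<xi>) ^ k /\<^sub>R fact k)"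
      using \<open>0 \<le> c * g \<xi>\<close> by (intro sum_nonneg) auto
    moreover have "(\<Sum>k<n. (c * g \<xi>) ^ k /\<^sub>R fact k) \<le> exp (c * g \<xi>)"
      unfolding exp_def using \<open>0 \<le> c * g \<xi>\<close>
      by (intro sum_le_suminf summable_exp_generic) auto
    moreover have "exp (c * g \<xi>) \<le> exp (c * B)"
      using \<open>c * g \<xi> \<le> c * B\<close> by simp
    ultimately show ?thesis
      by linarith
  qed
  show "(\<lambda>n. \<Sum>k<n. (c * g \<xi>) ^ k /\<^sub>R fact k) \<longlonglongrightarrow> exp (c * g \<xi>)" for \<xi>
    unfolding exp_def by (intro summable_LIMSEQ summable_exp_generic)
qed

text \<open>
  Passing from one coefficient to the next multiplies by the nonnegative number
  \<open>(k + 1 - b) / (k + 2)\<close>; this is where \<open>b \<le> 1\<close> enters.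
\<close>

lemma gbinomial_alternating_nonneg:
  fixes b :: real
  assumes "0 < b" "b \<le> 1"
  shows "0 \<le> - ((b gchoose Suc k) * (- 1) ^ Suc k)"
proof (induction k)
  case 0
  then show ?case using assms by simp
next
  case (Suc k)
  have "b gchoose Suc (Suc k) = (b gchoose Suc k) * (b - real (Suc k)) / real (Suc (Suc k))"
    using gbinomial_absorb_comp[of b "Suc k"] gbinomial_absorption'[of "Suc (Suc k)" b]
    by (simp add: field_simps gbinomial_mult_1)
  note rec = this
  have "- ((b gchoose Suc (Suc k)) * (- 1) ^ Suc (Suc k))
      = - ((b gchoose Suc k) * (- 1) ^ Suc k) * ((real (Suc k) - b) / real (Suc (Suc k)))"
    unfolding rec by (simp add: field_simps)
  then show ?case
    using Suc assms by (auto intro!: mult_nonneg_nonneg)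
qed

lemma one_minus_powr_series:
  fixes b x :: real
  assumes x: "0 \<le> x" "x < 1"
  shows "(\<lambda>k. - ((b gchoose Suc k) * (- 1) ^ Suc k) * x ^ Suc k) sums (1 - (1 - x) powr b)"
proof -
  have "(\<lambda>k. (b gchoose k) * (- x) ^ k) sums (1 - x) powr b"
    using gen_binomial_real[of "- x" b] x by simp
  then have "(\<lambda>k. (b gchoose Suc k) * (- x) ^ Suc k) sums ((1 - x) powr b - 1)"
    using sums_Suc_iff[of "\<lambda>k. (b gchoose k) * (- x) ^ k" "(1 - x) powr b - 1"] by simp
  from sums_minus[OF this] show ?thesis
    by (simp add: power_minus[of x] mult_ac)
qed

text \<open>
  The function is the limit of \<open>exp (- (n (1 - x)) powr b)\<close> with \<open>x\<close> a multiple of the Gaussian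
  \<open>exp (- \<bar>\<xi>\<bar>\<^sup>2 / n)\<close>, and each of these is a positive constant times the exponential of
  \<open>n powr b (1 - (1 - x) powr b)\<close>, a power series in \<open>x\<close> with nonnegative coefficients.
\<close>

lemma gauss_pos_exp_neg_powr:
  assumes b: "0 < b" "b \<le> 1"
  shows "gauss_pos (\<lambda>\<xi>::'a::euclidean_space. exp (- (((norm \<xi>)\<^sup>2) powr b)))"
proof (rule gauss_pos_limit)
  let ?c = "\<lambda>k. case k of 0 \<Rightarrow> 0 | Suc j \<Rightarrow> - ((b gchoose Suc j) * (- 1) ^ Suc j)"
  \<comment> \<open>The factor \<open>r\<close> keeps \<open>x\<close> strictly below one, so that the binomial series also converges at
    the origin; it is close enough to one not to change the limit of \<open>n (1 - x)\<close>.\<close>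
  define r where "r n = exp (- 1 / real (Suc n) ^ 2)" for n
  define x where "x n \<xi> = r n * exp (- (1 / real (Suc n)) * (norm \<xi>)\<^sup>2)" for n and \<xi> :: 'a
  have r: "0 \<le> r n" "r n < 1" for n
    by (auto simp: r_def)
  have x: "0 \<le> x n \<xi>" "x n \<xi> < 1" for n \<xi>
    unfolding x_def using r[of n] by (auto intro: mult_left_le[THEN order.strict_trans1])
  have c: "0 \<le> ?c k" for k
    using gbinomial_alternating_nonneg[OF b] by (auto split: nat.split)
  have series: "(\<lambda>k. ?c k * y ^ k) sums (1 - (1 - y) powr b)" if "0 \<le> y" "y < 1" for y
    using one_minus_powr_series[OF that, of b] sums_Suc_iff[of "\<lambda>k. ?c k * y ^ k" "1 - (1 - y) powr b"]
    by simp
  show "gauss_pos (\<lambda>\<xi>::'a. exp (- (real (Suc n) powr b)) * exp (real (Suc n) powr b * (1 - (1 - x n \<xi>) powr b)))" for n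
  proof (intro gauss_pos_cmult gauss_pos_exp)
    show "gauss_pos (\<lambda>\<xi>. f \<xi> * (1 - (1 - x n \<xi>) powr b))" if "gauss_pos f" for f :: "'a \<Rightarrow> real"
      using gauss_pos_power_series[OF that c r(1)[of n], of "1 / real (Suc n)"] series[OF r, of n]
        series[OF x, THEN sums_unique, of n]
      by (simp add: x_def sums_iff)
    show "0 \<le> 1 - (1 - x n \<xi>) powr b" for \<xi>
      using x[of n \<xi>] b by (auto intro: powr_le1)
    show "1 - (1 - x n \<xi>) powr b \<le> 1" for \<xi>
      by simp
  qed auto
  have "exp (- (real (Suc n) powr b)) * exp (real (Suc n) powr b * (1 - (1 - x n \<xi>) powr b))
      = exp (- ((real (Suc n) * (1 - x n \<xi>)) powr b))" for n \<xi>
  proof -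
    have "(real (Suc n) * (1 - x n \<xi>)) powr b = real (Suc n) powr b * (1 - x n \<xi>) powr b"
      by (rule powr_mult)
    then show ?thesis
      by (simp add: exp_add[symmetric] right_diff_distrib del: of_nat_Suc)
  qed
  note eq = this
  show "\<bar>exp (- (real (Suc n) powr b)) * exp (real (Suc n) powr b * (1 - (1 - x n \<xi>) powr b))\<bar> \<le> 1" for n \<xi>
    unfolding eq by simp
  show "(\<lambda>n. exp (- (real (Suc n) powr b)) * exp (real (Suc n) powr b * (1 - (1 - x n \<xi>) powr b)))
      \<longlonglongrightarrow> exp (- (((norm \<xi>)\<^sup>2) powr b))" for \<xi>
  proof -
    have "(\<lambda>n. real (Suc n) * (1 - exp (- 1 / real (Suc n) ^ 2) * exp (- (1 / real (Suc n)) * y))) \<longlonglongrightarrow> y" for y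
      by real_asymp
    then have "(\<lambda>n. real (Suc n) * (1 - x n \<xi>)) \<longlonglongrightarrow> (norm \<xi>)\<^sup>2"
      unfolding x_def r_def .
    then show ?thesis
      unfolding eq using x b
      by (intro tendsto_exp tendsto_minus tendsto_powr' tendsto_const) (auto simp: less_imp_le)
  qed
qed

section \<open>Fourier inversion for nonnegative transforms\<close>

lemma lborel_affine_euclidean_integral:
  fixes f :: "'a::euclidean_space \<Rightarrow> 'b::{banach, second_countable_topology}"
  assumes c: "c \<noteq> 0" and f[measurable]: "f \<in> borel_measurable borel"
  shows "integrable lborel (\<lambda>x. f (t + c *\<^sub>R x)) \<longleftrightarrow> integrable lborel f"
    and "(\<integral>x. f x \<partial>lborel) = \<bar>c\<bar> ^ DIM('a) *\<^sub>R (\<integral>x. f (t + c *\<^sub>R x) \<partial>lborel)"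
proof -
  have eq: "lborel = density (distr lborel borel (\<lambda>x. t + c *\<^sub>R x)) (\<lambda>_. ennreal (\<bar>c\<bar> ^ DIM('a)))"
    using lborel_affine[OF c, of t] by (simp add: ennreal_power)
  show "integrable lborel (\<lambda>x. f (t + c *\<^sub>R x)) \<longleftrightarrow> integrable lborel f"
  proof -
    have "integrable lborel f \<longleftrightarrow> integrable lborel (\<lambda>x. \<bar>c\<bar> ^ DIM('a) *\<^sub>R f (t + c *\<^sub>R x))"
      by (subst eq) (simp add: integrable_density integrable_distr_eq)
    also have "\<dots> \<longleftrightarrow> integrable lborel (\<lambda>x. f (t + c *\<^sub>R x))" (is "integrable _ ?g \<longleftrightarrow> integrable _ ?h")
    proof
      assume "integrable lborel ?g"
      from integrable_scaleR_right[OF this, of "inverse (\<bar>c\<bar> ^ DIM('a))"] show "integrable lborel ?h"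
        using c by simp
    qed auto
    finally show ?thesis ..
  qed
  show "(\<integral>x. f x \<partial>lborel) = \<bar>c\<bar> ^ DIM('a) *\<^sub>R (\<integral>x. f (t + c *\<^sub>R x) \<partial>lborel)"
    by (subst eq) (simp add: integral_density integral_distr)
qed

text \<open>
  With a Gaussian weight the order of integration may be exchanged in the inversion integral, and
  the inner integral is then an explicit Gaussian centred at \<open>\<eta>\<close>. Rescaling it to unit width
  moves the parameter \<open>\<delta>\<close> into the argument of \<open>\<phi>\<close>, ready for the limit \<open>\<delta> \<rightarrow> 0\<close>.
\<close>

lemma gaussian_regularised_inversion:
  fixes \<phi> :: "'a::euclidean_space \<Rightarrow> real" and \<eta> :: 'a
  assumes int: "integrable lborel \<phi>" and \<delta>: "0 < \<delta>"
  shows "(\<integral>v. exp (- (\<delta> / 2) * (norm v)\<^sup>2) *\<^sub>R ((\<integral>\<xi>. \<phi> \<xi> *\<^sub>R cis (v \<bullet> \<xi>) \<partial>lborel) * cis (- (\<eta> \<bullet> v))) \<partial>lborel)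
    = of_real ((2 * pi) powr (DIM('a) / 2)
        * (\<integral>z. \<phi> (\<eta> + sqrt \<delta> *\<^sub>R z) * exp (- (1 / 2) * (norm z)\<^sup>2) \<partial>lborel))"
proof -
  have [measurable]: "\<phi> \<in> borel_measurable borel"
    using int by auto
  let ?G = "\<lambda>v::'a. exp (- (\<delta> / 2) * (norm v)\<^sup>2)"
  let ?f = "\<lambda>v \<xi>. (?G v * \<phi> \<xi>) *\<^sub>R cis ((\<xi> - \<eta>) \<bullet> v)"
  have dist: "cis (v \<bullet> \<xi>) * cis (- (\<eta> \<bullet> v)) = cis ((\<xi> - \<eta>) \<bullet> v)" for v \<xi>
    by (simp add: cis_mult inner_diff_left inner_diff_right inner_commute[of v])
  have fub: "integrable (lborel \<Otimes>\<^sub>M lborel) (case_prod ?f)"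
  proof (rule lborel_pair.Fubini_integrable)
    show "integrable lborel (\<lambda>v. \<integral>\<xi>. norm (case_prod ?f (v, \<xi>)) \<partial>lborel)"
      using integrable_gaussian[OF \<delta>, where 'a='a] by (simp add: abs_mult)
    show "AE v in lborel. integrable lborel (\<lambda>\<xi>. case_prod ?f (v, \<xi>))"
    proof (rule AE_I2, rule Bochner_Integration.integrable_bound)
      show "integrable lborel (\<lambda>\<xi>. ?G v * \<phi> \<xi>)" for v
        by (intro integrable_mult_right int)
    qed auto
  qed measurable
  have "(\<integral>v. ?G v *\<^sub>R ((\<integral>\<xi>. \<phi> \<xi> *\<^sub>R cis (v \<bullet> \<xi>) \<partial>lborel) * cis (- (\<eta> \<bullet> v))) \<partial>lborel)
      = (\<integral>v. (\<integral>\<xi>. ?f v \<xi> \<partial>lborel) \<partial>lborel)"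
    by (simp add: integral_mult_left_zero[symmetric] integral_scaleR_right[symmetric] dist[symmetric]
        del: integral_mult_left_zero integral_scaleR_right)
  also have "\<dots> = (\<integral>\<xi>. (\<integral>v. ?f v \<xi> \<partial>lborel) \<partial>lborel)"
    by (rule lborel_pair.Fubini_integral[OF fub, symmetric])
  also have "\<dots> = (\<integral>\<xi>. of_real ((2 * pi / \<delta>) powr (DIM('a) / 2) * (\<phi> \<xi> * exp (- (norm (\<xi> - \<eta>))\<^sup>2 / (2 * \<delta>)))) \<partial>lborel)"
  proof (intro Bochner_Integration.integral_cong refl)
    fix \<xi> :: 'a
    have "(\<integral>v. ?f v \<xi> \<partial>lborel) = \<phi> \<xi> *\<^sub>R (\<integral>v. ?G v *\<^sub>R cis ((\<xi> - \<eta>) \<bullet> v) \<partial>lborel)"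
      by (simp add: integral_scaleR_right[symmetric] mult.commute del: integral_scaleR_right)
    then show "(\<integral>v. ?f v \<xi> \<partial>lborel)
        = of_real ((2 * pi / \<delta>) powr (DIM('a) / 2) * (\<phi> \<xi> * exp (- (norm (\<xi> - \<eta>))\<^sup>2 / (2 * \<delta>))))"
      unfolding gaussian_fourier(2)[OF \<delta>] by (simp add: scaleR_conv_of_real mult_ac)
  qed
  also have "\<dots> = of_real ((2 * pi / \<delta>) powr (DIM('a) / 2)
      * (\<integral>\<xi>. \<phi> \<xi> * exp (- (norm (\<xi> - \<eta>))\<^sup>2 / (2 * \<delta>)) \<partial>lborel))"
    by (simp only: integral_complex_of_real integral_mult_right_zero)
  also have "(\<integral>\<xi>. \<phi> \<xi> * exp (- (norm (\<xi> - \<eta>))\<^sup>2 / (2 * \<delta>)) \<partial>lborel)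
      = sqrt \<delta> ^ DIM('a) * (\<integral>z. \<phi> (\<eta> + sqrt \<delta> *\<^sub>R z) * exp (- (1 / 2) * (norm z)\<^sup>2) \<partial>lborel)"
    using \<delta> by (subst lborel_affine_euclidean_integral(2)[where c="sqrt \<delta>" and t=\<eta>])
      (auto simp: power_mult_distrib)
  also have "(2 * pi / \<delta>) powr (DIM('a) / 2) * (sqrt \<delta> ^ DIM('a) * J)
      = (2 * pi) powr (DIM('a) / 2) * J" for J :: real
  proof -
    have "sqrt \<delta> ^ DIM('a) = \<delta> powr (DIM('a) / 2)"
      using \<delta> by (simp add: powr_half_sqrt[symmetric] powr_realpow[symmetric] powr_powr)
    then show ?thesis
      using \<delta> by (simp add: powr_divide)
  qed
  finally show ?thesis .
qed

text \<open>
  Inversion without assuming that the transform is integrable: the regularised integrals at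
  \<open>\<eta> = 0\<close> converge, and since the transform is nonnegative they increase to its integral, so that
  integrability follows by monotone convergence. Dominated convergence then removes the
  regularisation at every \<open>\<eta>\<close>.
\<close>

lemma fourier_inversion_nonneg:
  fixes \<phi> :: "'a::euclidean_space \<Rightarrow> real"
  assumes int: "integrable lborel \<phi>" and cont: "continuous_on UNIV \<phi>" and B: "\<And>\<xi>. \<bar>\<phi> \<xi>\<bar> \<le> B"
    and pos: "\<And>v. (\<integral>\<xi>. \<phi> \<xi> *\<^sub>R cis (v \<bullet> \<xi>) \<partial>lborel) \<in> \<real>\<^sub>\<ge>\<^sub>0"
  defines "E v \<equiv> (2 * pi) powr (- real DIM('a)) * Re (\<integral>\<xi>. \<phi> \<xi> *\<^sub>R cis (v \<bullet> \<xi>) \<partial>lborel)"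
  shows "integrable lborel E" and "(\<integral>v. E v *\<^sub>R cis (- (\<eta> \<bullet> v)) \<partial>lborel) = of_real (\<phi> \<eta>)"
proof -
  have [measurable]: "\<phi> \<in> borel_measurable borel"
    using int by auto
  have [measurable]: "E \<in> borel_measurable borel"
    unfolding E_def by measurable
  let ?F = "\<lambda>v. \<integral>\<xi>. \<phi> \<xi> *\<^sub>R cis (v \<bullet> \<xi>) \<partial>lborel"
  let ?G = "\<lambda>n v::'a. exp (- (1 / real (Suc n) / 2) * (norm v)\<^sup>2)"
  have E_nonneg: "0 \<le> E v" for v
    using pos[of v] by (simp add: E_def complex_nonneg_Reals_iff)
  have FE: "?F v = of_real ((2 * pi) powr real DIM('a) * E v)" for v
    using pos[of v] by (simp add: E_def complex_nonneg_Reals_iff complex_eq_iff mult.assoc[symmetric] powr_add[symmetric])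
  have E_le: "\<bar>E v\<bar> \<le> (2 * pi) powr (- real DIM('a)) * (\<integral>\<xi>. \<bar>\<phi> \<xi>\<bar> \<partial>lborel)" for v
  proof -
    have "\<bar>Re (?F v)\<bar> \<le> cmod (?F v)"
      by (rule abs_Re_le_cmod)
    also have "\<dots> \<le> (\<integral>\<xi>. \<bar>\<phi> \<xi>\<bar> \<partial>lborel)"
      using integral_norm_bound[of lborel "\<lambda>\<xi>. \<phi> \<xi> *\<^sub>R cis (v \<bullet> \<xi>)"] by simp
    finally show ?thesis
      unfolding E_def abs_mult by (intro mult_mono) auto
  qed
  have reg: "(\<integral>v. (?G n v * E v) *\<^sub>R cis (- (\<eta> \<bullet> v)) \<partial>lborel)
      = of_real ((2 * pi) powr (- (DIM('a) / 2))
        * (\<integral>z. \<phi> (\<eta> + sqrt (1 / real (Suc n)) *\<^sub>R z) * exp (- (1 / 2) * (norm z)\<^sup>2) \<partial>lborel))" for n \<eta>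
  proof -
    have "(\<integral>v. ?G n v *\<^sub>R (?F v * cis (- (\<eta> \<bullet> v))) \<partial>lborel)
        = of_real ((2 * pi) powr real DIM('a)) * (\<integral>v. (?G n v * E v) *\<^sub>R cis (- (\<eta> \<bullet> v)) \<partial>lborel)"
      unfolding FE by (subst integral_mult_right_zero[symmetric]) (simp add: scaleR_conv_of_real mult_ac)
    moreover have "(2 * pi) powr (DIM('a) / 2) = (2 * pi) powr real DIM('a) * (2 * pi) powr (- (DIM('a) / 2))"
      by (simp add: powr_add[symmetric])
    ultimately show ?thesis
      using gaussian_regularised_inversion[OF int, of "1 / real (Suc n)" \<eta>]
      by (simp add: mult.assoc del: of_nat_Suc)
  qed
  have reg_lim: "(\<lambda>n. \<integral>v. (?G n v * E v) *\<^sub>R cis (- (\<eta> \<bullet> v)) \<partial>lborel) \<longlonglongrightarrow> of_real (\<phi> \<eta>)" for \<eta>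
  proof -
    have "(\<lambda>n. \<integral>z. \<phi> (\<eta> + sqrt (1 / real (Suc n)) *\<^sub>R z) * exp (- (1 / 2) * (norm z)\<^sup>2) \<partial>lborel)
        \<longlonglongrightarrow> (\<integral>z. \<phi> \<eta> * exp (- (1 / 2) * (norm (z::'a))\<^sup>2) \<partial>lborel)"
    proof (rule integral_dominated_convergence)
      show "integrable lborel (\<lambda>z::'a. B * exp (- (1 / 2) * (norm z)\<^sup>2))"
        using integrable_gaussian[of 1, where 'a='a] by (intro integrable_mult_right) auto
      show "AE z in lborel. norm (\<phi> (\<eta> + sqrt (1 / real (Suc n)) *\<^sub>R z) * exp (- (1 / 2) * (norm z)\<^sup>2))
          \<le> B * exp (- (1 / 2) * (norm z)\<^sup>2)" for n
        using B by (auto simp: abs_mult mult_right_mono)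
      have "(\<lambda>n. \<phi> (\<eta> + sqrt (1 / real (Suc n)) *\<^sub>R z)) \<longlonglongrightarrow> \<phi> \<eta>" for z
      proof -
        have "(\<lambda>n. \<eta> + sqrt (1 / real (Suc n)) *\<^sub>R z) \<longlonglongrightarrow> \<eta> + sqrt 0 *\<^sub>R z"
          using lim_inverse_n' LIMSEQ_Suc by (intro tendsto_intros) blast
        then have "(\<lambda>n. \<eta> + sqrt (1 / real (Suc n)) *\<^sub>R z) \<longlonglongrightarrow> \<eta>"
          by simp
        then show ?thesis
          by (rule continuous_on_tendsto_compose[OF cont]) auto
      qed
      then show "AE z in lborel. (\<lambda>n. \<phi> (\<eta> + sqrt (1 / real (Suc n)) *\<^sub>R z) * exp (- (1 / 2) * (norm z)\<^sup>2))
          \<longlonglongrightarrow> \<phi> \<eta> * exp (- (1 / 2) * (norm z)\<^sup>2)"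
        by (intro AE_I2 tendsto_intros)
    qed measurable
    moreover have "(\<integral>z. \<phi> \<eta> * exp (- (1 / 2) * (norm (z::'a))\<^sup>2) \<partial>lborel) = \<phi> \<eta> * (2 * pi) powr (DIM('a) / 2)"
    proof -
      have "complex_of_real (\<integral>z. exp (- (1 / 2) * (norm (z::'a))\<^sup>2) \<partial>lborel) = of_real ((2 * pi) powr (DIM('a) / 2))"
        using gaussian_fourier(2)[of 1 "0::'a"] unfolding integral_complex_of_real[symmetric]
        by (simp add: scaleR_conv_of_real)
      then show ?thesis
        by (simp only: integral_mult_right_zero of_real_eq_iff)
    qed
    ultimately have "(\<lambda>n. of_real ((2 * pi) powr (- (DIM('a) / 2))
        * (\<integral>z. \<phi> (\<eta> + sqrt (1 / real (Suc n)) *\<^sub>R z) * exp (- (1 / 2) * (norm z)\<^sup>2) \<partial>lborel)))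
      \<longlonglongrightarrow> complex_of_real ((2 * pi) powr (- (DIM('a) / 2)) * (\<phi> \<eta> * (2 * pi) powr (DIM('a) / 2)))"
      by (intro tendsto_of_real tendsto_mult tendsto_const) (simp only:)
    moreover have "(2 * pi) powr (- (DIM('a) / 2)) * (\<phi> \<eta> * (2 * pi) powr (DIM('a) / 2)) = \<phi> \<eta>"
      by (simp add: powr_minus)
    ultimately show ?thesis
      unfolding reg by (simp only:)
  qed
  have G_lim: "(\<lambda>n. ?G n v) \<longlonglongrightarrow> 1" for v
  proof -
    have "(\<lambda>n. ?G n v) \<longlonglongrightarrow> exp (- (0 / 2) * (norm v)\<^sup>2)"
      using lim_inverse_n' LIMSEQ_Suc by (intro tendsto_intros) (blast, simp)
    then show ?thesis
      by simp
  qed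
  show intE: "integrable lborel E"
  proof (rule integrable_monotone_convergence)
    show "integrable lborel (\<lambda>v. ?G n v * E v)" for n
    proof (rule Bochner_Integration.integrable_bound)
      show "integrable lborel (\<lambda>v::'a. ?G n v * ((2 * pi) powr (- real DIM('a)) * (\<integral>\<xi>. \<bar>\<phi> \<xi>\<bar> \<partial>lborel)))"
        by (intro integrable_mult_left integrable_gaussian) auto
      show "AE v in lborel. norm (?G n v * E v)
          \<le> norm (?G n v * ((2 * pi) powr (- real DIM('a)) * (\<integral>\<xi>. \<bar>\<phi> \<xi>\<bar> \<partial>lborel)))"
        using E_le unfolding norm_mult by (intro AE_I2 mult_left_mono) (auto intro: order_trans)
    qed measurable
    show "AE v in lborel. mono (\<lambda>n. ?G n v * E v)"
    proof (intro AE_I2 monoI mult_right_mono E_nonneg)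
      show "?G m v \<le> ?G n v" if "m \<le> n" for m n and v :: 'a
      proof -
        have "1 / real (Suc n) \<le> 1 / real (Suc m)"
          using that by (intro divide_left_mono) auto
        then have "1 / real (Suc n) / 2 * (norm v)\<^sup>2 \<le> 1 / real (Suc m) / 2 * (norm v)\<^sup>2"
          by (intro mult_right_mono divide_right_mono) auto
        then show ?thesis
          by (simp only: exp_le_cancel_iff mult_minus_left neg_le_iff_le)
      qed
    qed
    show "AE v in lborel. (\<lambda>n. ?G n v * E v) \<longlonglongrightarrow> E v"
    proof (rule AE_I2)
      fix v
      have "(\<lambda>n. ?G n v * E v) \<longlonglongrightarrow> 1 * E v"
        by (intro tendsto_intros G_lim)
      then show "(\<lambda>n. ?G n v * E v) \<longlonglongrightarrow> E v"
        by simp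
    qed
    \<comment> \<open>At \<open>\<eta> = 0\<close> the character is constant, which turns the complex limit into a real one.\<close>
    have "(\<integral>v. (?G n v * E v) *\<^sub>R cis (- (0 \<bullet> v)) \<partial>lborel) = of_real (\<integral>v. ?G n v * E v \<partial>lborel)" for n
      unfolding integral_complex_of_real[symmetric] by (simp add: scaleR_conv_of_real)
    then have "(\<lambda>n. complex_of_real (\<integral>v. ?G n v * E v \<partial>lborel)) \<longlonglongrightarrow> of_real (\<phi> 0)"
      using reg_lim[of 0] by (simp only:)
    then show "(\<lambda>n. \<integral>v. ?G n v * E v \<partial>lborel) \<longlonglongrightarrow> \<phi> 0"
      by (simp only: tendsto_of_real_iff)
  qed measurable
  have "(\<lambda>n. \<integral>v. (?G n v * E v) *\<^sub>R cis (- (\<eta> \<bullet> v)) \<partial>lborel) \<longlonglongrightarrow> (\<integral>v. E v *\<^sub>R cis (- (\<eta> \<bullet> v)) \<partial>lborel)"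
  proof (rule integral_dominated_convergence)
    show "AE v in lborel. (\<lambda>n. (?G n v * E v) *\<^sub>R cis (- (\<eta> \<bullet> v))) \<longlonglongrightarrow> E v *\<^sub>R cis (- (\<eta> \<bullet> v))"
    proof (rule AE_I2)
      fix v
      have "(\<lambda>n. (?G n v * E v) *\<^sub>R cis (- (\<eta> \<bullet> v))) \<longlonglongrightarrow> (1 * E v) *\<^sub>R cis (- (\<eta> \<bullet> v))"
        by (intro tendsto_intros G_lim)
      then show "(\<lambda>n. (?G n v * E v) *\<^sub>R cis (- (\<eta> \<bullet> v))) \<longlonglongrightarrow> E v *\<^sub>R cis (- (\<eta> \<bullet> v))"
        by simp
    qed
    show "AE v in lborel. norm ((?G n v * E v) *\<^sub>R cis (- (\<eta> \<bullet> v))) \<le> E v" for n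
      using E_nonneg by (auto simp: abs_mult intro!: mult_left_le_one_le)
    show "integrable lborel E"
      by (rule intE)
  qed measurable
  then show "(\<integral>v. E v *\<^sub>R cis (- (\<eta> \<bullet> v)) \<partial>lborel) = of_real (\<phi> \<eta>)"
    by (rule LIMSEQ_unique[OF _ reg_lim])
qed

section \<open>Radial integrals\<close>

text \<open>
  Polar coordinates, with \<open>s = t \<bar>\<xi>\<bar>\<^sup>p\<close> as radial variable. The image of Lebesgue measure under
  this map is determined by the volumes of its sublevel sets; these are balls, whose volume is a
  multiple of \<open>s powr (d / p)\<close>.
\<close>

lemma nn_integral_radial_powr:
  fixes p t :: real and g :: "real \<Rightarrow> ennreal"
  assumes p: "0 < p" and t: "0 < t" and g[measurable]: "g \<in> borel_measurable borel"
  defines "q \<equiv> real DIM('a::euclidean_space) / p"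
  shows "(\<integral>\<^sup>+\<xi>. g (t * norm \<xi> powr p) \<partial>(lborel :: 'a measure)) =
    ennreal (unit_ball_vol (real DIM('a)) * q * t powr (- q)) *
      (\<integral>\<^sup>+s. g s * ennreal (s powr (q - 1)) * indicator {0<..} s \<partial>lborel)"
proof -
  let ?V = "unit_ball_vol (real DIM('a))"
  let ?C = "?V * q * t powr (- q)"
  let ?T = "\<lambda>\<xi>::'a. t * norm \<xi> powr p"
  let ?N = "density lborel (\<lambda>s. ennreal ?C * (ennreal (s powr (q - 1)) * indicator {0<..} s))"
  have q: "q > 0"
    using p by (simp add: q_def)
  have eq: "distr lborel borel ?T = ?N"
  proof (rule measure_eqI_generator_eq[where E="range (\<lambda>a::real. {..a})" and \<Omega>=UNIV
        and A="\<lambda>n::nat. {..real n}"])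
    show "Int_stable (range (\<lambda>a::real. {..a}))"
      by (auto simp: Int_stable_def)
    show "(\<Union>n::nat. {..real n}) = UNIV"
      by (auto simp: real_arch_simple)
    have N: "emeasure ?N {..a} = (if a < 0 then 0 else ennreal (?V * (a / t) powr q))" for a
    proof (cases "a < 0")
      case True
      then show ?thesis
        by (subst emeasure_density) (auto simp: nn_integral_0_iff_AE indicator_def)
    next
      case False
      have I: "((\<lambda>s. s powr (q - 1)) has_integral (a powr q / q)) {0..a}"
        using has_integral_powr_from_0[of "q - 1" a] q False by simp
      have "emeasure ?N {..a} = (\<integral>\<^sup>+s. ennreal ?C * (ennreal (indicator {0..a} s * s powr (q - 1))) \<partial>lborel)"
        by (subst emeasure_density, measurable, rule nn_integral_cong_AE,
            rule AE_mp[OF AE_lborel_singleton[of 0]], rule AE_I2) (auto simp: indicator_def)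
      also have "\<dots> = ennreal ?C * ennreal (a powr q / q)"
        using nn_integral_has_integral_lebesgue[OF _ I] by (subst nn_integral_cmult) auto
      also have "\<dots> = ennreal (?V * (a / t) powr q)"
        using q t False by (simp add: ennreal_mult'[symmetric] powr_divide powr_minus field_simps)
      finally show ?thesis
        using False by simp
    qed
    have M: "emeasure (distr lborel borel ?T) {..a} = (if a < 0 then 0 else ennreal (?V * (a / t) powr q))" for a
    proof (cases "a < 0")
      case True
      moreover have "0 \<le> ?T \<xi>" for \<xi>
        using t by simp
      ultimately have "?T -` {..a} = {}"
        by (auto simp: set_eq_iff not_le intro: less_le_trans)
      then show ?thesis
        using True by (subst emeasure_distr) auto
    next
      case False
      have "t * norm \<xi> powr p \<le> a \<longleftrightarrow> norm \<xi> \<le> (a / t) powr (1 / p)" for \<xi> :: 'a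
      proof -
        have "t * norm \<xi> powr p \<le> a \<longleftrightarrow> norm \<xi> powr p \<le> a / t"
          using t by (simp add: field_simps)
        also have "\<dots> \<longleftrightarrow> norm \<xi> \<le> (a / t) powr (1 / p)"
        proof
          assume "norm \<xi> powr p \<le> a / t"
          then have "(norm \<xi> powr p) powr (1 / p) \<le> (a / t) powr (1 / p)"
            using p by (intro powr_mono2) auto
          then show "norm \<xi> \<le> (a / t) powr (1 / p)"
            using p by (simp add: powr_powr)
        next
          assume "norm \<xi> \<le> (a / t) powr (1 / p)"
          then have "norm \<xi> powr p \<le> ((a / t) powr (1 / p)) powr p"
            using p by (intro powr_mono2) auto
          then show "norm \<xi> powr p \<le> a / t"
            using p t False by (simp add: powr_powr)
        qed
        finally show ?thesis .
      qed
      then have "?T -` {..a} = cball 0 ((a / t) powr (1 / p))"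
        by auto
      moreover have "((a / t) powr (1 / p)) ^ DIM('a) = (a / t) powr q"
        using False t by (cases "a = 0") (auto simp: powr_realpow[symmetric] powr_powr q_def)
      ultimately show ?thesis
        using False by (subst emeasure_distr) (auto simp: emeasure_cball)
    qed
    show "emeasure (distr lborel borel ?T) X = emeasure ?N X" if "X \<in> range (\<lambda>a::real. {..a})" for X
      using that M N by auto
    show "emeasure (distr lborel borel ?T) {..real i} \<noteq> \<infinity>" for i :: nat
      using M by simp
  qed (auto simp: borel_eq_atMost)
  have "(\<integral>\<^sup>+\<xi>. g (t * norm \<xi> powr p) \<partial>(lborel :: 'a measure)) = integral\<^sup>N (distr lborel borel ?T) g"
    by (subst nn_integral_distr) auto
  also have "\<dots> = (\<integral>\<^sup>+s. ennreal ?C * (g s * ennreal (s powr (q - 1)) * indicator {0<..} s) \<partial>lborel)"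
    unfolding eq by (subst nn_integral_density) (auto simp: mult_ac)
  finally show ?thesis
    by (subst (asm) nn_integral_cmult) auto
qed

text \<open>
  Integration by parts, carried out as an exchange of integrals: \<open>1 - exp (- s)\<close> is the integral
  of \<open>exp (- u)\<close> over \<open>{0..s}\<close>, and integrating the power over \<open>{u..}\<close> first leaves the Gamma
  integral.
\<close>

lemma nn_integral_one_minus_exp_powr:
  fixes a :: real
  assumes a: "0 < a" "a < 1"
  shows "(\<integral>\<^sup>+s. ennreal (1 - exp (- s)) * ennreal (s powr (- a - 1)) * indicator {0<..} s \<partial>lborel)
    = ennreal (Gamma (1 - a) / a)"
proof -
  have head: "(\<integral>\<^sup>+u. ennreal (exp (- u)) * indicator {0..s} u \<partial>lborel) = ennreal (1 - exp (- s))"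
    if "0 < s" for s :: real
    using that by (subst nn_integral_FTC_Icc[where F="\<lambda>u. - exp (- u)"])
      (auto intro!: derivative_eq_intros)
  have tail: "(\<integral>\<^sup>+s. ennreal (s powr (- a - 1)) * indicator {u..} s \<partial>lborel) = ennreal (u powr (- a) / a)"
    if "0 < u" for u :: real
  proof -
    have "((\<lambda>x. - (x powr - a) / a) \<longlongrightarrow> - 0 / a) at_top"
      using a by (intro tendsto_intros tendsto_neg_powr filterlim_ident) auto
    then show ?thesis
      using that a
      by (subst nn_integral_FTC_atLeast[where F="\<lambda>x. - (x powr - a) / a" and T=0])
        (auto intro!: derivative_eq_intros simp: field_simps)
  qed
  have "(\<integral>\<^sup>+s. ennreal (1 - exp (- s)) * ennreal (s powr (- a - 1)) * indicator {0<..} s \<partial>lborel)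
    = (\<integral>\<^sup>+s. (\<integral>\<^sup>+u. ennreal (exp (- u)) * indicator {0..s} u
          * (ennreal (s powr (- a - 1)) * indicator {0<..} s) \<partial>lborel) \<partial>lborel)"
  proof (intro nn_integral_cong)
    fix s :: real
    show "ennreal (1 - exp (- s)) * ennreal (s powr (- a - 1)) * indicator {0<..} s
      = (\<integral>\<^sup>+u. ennreal (exp (- u)) * indicator {0..s} u
          * (ennreal (s powr (- a - 1)) * indicator {0<..} s) \<partial>lborel)"
      by (cases "0 < s") (subst nn_integral_multc; simp add: head mult_ac)+
  qed
  also have "\<dots> = (\<integral>\<^sup>+u. (\<integral>\<^sup>+s. ennreal (exp (- u)) * indicator {0..s} u
          * (ennreal (s powr (- a - 1)) * indicator {0<..} s) \<partial>lborel) \<partial>lborel)"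
  proof (rule lborel_pair.Fubini')
    have "(\<lambda>(u, s). ennreal (exp (- u)) * indicator {(u, s). 0 \<le> u \<and> u \<le> s} (u, s)
          * (ennreal (s powr (- a - 1)) * indicator {0<..} s)) \<in> borel_measurable (lborel \<Otimes>\<^sub>M lborel)"
      by measurable
    then show "(\<lambda>(u, s). ennreal (exp (- u)) * indicator {0..s} u
          * (ennreal (s powr (- a - 1)) * indicator {0<..} s)) \<in> borel_measurable (lborel \<Otimes>\<^sub>M lborel)"
      by (rule measurable_cong[THEN iffD1, rotated]) (auto simp: indicator_def)
  qed
  also have "\<dots> = (\<integral>\<^sup>+u. ennreal (indicator {0..} u * u powr ((1 - a) - 1) / exp u / a) \<partial>lborel)"
  proof (rule nn_integral_cong_AE, rule AE_mp[OF AE_lborel_singleton[of 0]], rule AE_I2, rule impI)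
    fix u :: real assume "u \<noteq> 0"
    show "(\<integral>\<^sup>+s. ennreal (exp (- u)) * indicator {0..s} u
          * (ennreal (s powr (- a - 1)) * indicator {0<..} s) \<partial>lborel)
        = ennreal (indicator {0..} u * u powr ((1 - a) - 1) / exp u / a)"
    proof (cases "0 < u")
      case True
      have "(\<integral>\<^sup>+s. ennreal (exp (- u)) * indicator {0..s} u
          * (ennreal (s powr (- a - 1)) * indicator {0<..} s) \<partial>lborel)
        = (\<integral>\<^sup>+s. ennreal (exp (- u)) * (ennreal (s powr (- a - 1)) * indicator {u..} s) \<partial>lborel)"
        using True by (intro nn_integral_cong) (auto simp: indicator_def)
      also have "\<dots> = ennreal (exp (- u)) * ennreal (u powr (- a) / a)"
        using True by (subst nn_integral_cmult) (auto simp: tail)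
      finally show ?thesis
        using True a by (simp add: ennreal_mult'[symmetric] exp_minus field_simps)
    qed (use \<open>u \<noteq> 0\<close> in auto)
  qed
  also have "\<dots> = (\<integral>\<^sup>+u. ennreal (indicator {0..} u * u powr ((1 - a) - 1) / exp u) / ennreal a \<partial>lborel)"
    using a by (intro nn_integral_cong) (auto simp: divide_ennreal indicator_def)
  also have "\<dots> = ennreal (Gamma (1 - a)) / ennreal a"
    using a by (subst nn_integral_divide) (auto simp: Gamma_conv_nn_integral_real)
  also have "\<dots> = ennreal (Gamma (1 - a) / a)"
    using a by (simp add: divide_ennreal Gamma_real_pos less_imp_le)
  finally show ?thesis .
qed

text \<open>
  The polar integral behind the constant of the theorem. The dimension enters through
  \<open>d\<close> times the volume of the unit ball, which is the surface area
  \<open>2 pi powr (d / 2) / Gamma (d / 2)\<close> of the unit sphere.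
\<close>

lemma nn_integral_damping_defect:
  fixes p t \<alpha> :: real
  assumes p: "0 < p" and t: "0 < t" and \<alpha>: "0 < \<alpha>" "\<alpha> < p"
  shows "(\<integral>\<^sup>+\<xi>. ennreal ((1 - exp (- t * norm \<xi> powr p)) / norm \<xi> powr (real DIM('a) + \<alpha>))
      \<partial>(lborel :: 'a::euclidean_space measure))
    = ennreal (2 * pi powr (real DIM('a) / 2) * Gamma (1 - \<alpha> / p)
        / (\<alpha> * Gamma (real DIM('a) / 2)) * t powr (\<alpha> / p))"
proof -
  let ?d = "real DIM('a)"
  define q where "q = ?d / p"
  \<comment> \<open>The integrand in terms of \<open>s = t \<bar>\<xi>\<bar>\<^sup>p\<close>, where \<open>\<bar>\<xi>\<bar> = (s / t) powr (1 / p)\<close>.\<close>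
  define g where "g s = ennreal ((1 - exp (- s)) / (s / t) powr ((?d + \<alpha>) / p))" for s
  have [measurable]: "g \<in> borel_measurable borel"
    unfolding g_def by measurable
  have "(\<integral>\<^sup>+\<xi>. ennreal ((1 - exp (- t * norm \<xi> powr p)) / norm \<xi> powr (?d + \<alpha>)) \<partial>(lborel :: 'a measure))
      = (\<integral>\<^sup>+\<xi>. g (t * norm \<xi> powr p) \<partial>(lborel :: 'a measure))"
    using p t by (simp add: g_def powr_powr)
  also have "\<dots> = ennreal (unit_ball_vol ?d * q * t powr (- q)) *
      (\<integral>\<^sup>+s. g s * ennreal (s powr (q - 1)) * indicator {0<..} s \<partial>lborel)"
    unfolding q_def by (rule nn_integral_radial_powr[OF p t]) measurable
  also have "(\<integral>\<^sup>+s. g s * ennreal (s powr (q - 1)) * indicator {0<..} s \<partial>lborel)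
      = (\<integral>\<^sup>+s. ennreal (t powr (q + \<alpha> / p)) * (ennreal (1 - exp (- s)) * ennreal (s powr (- (\<alpha> / p) - 1)) * indicator {0<..} s) \<partial>lborel)"
  proof (intro nn_integral_cong)
    fix s :: real
    have "(1 - exp (- s)) / (s / t) powr ((?d + \<alpha>) / p) * s powr (q - 1)
        = t powr (q + \<alpha> / p) * ((1 - exp (- s)) * s powr (- (\<alpha> / p) - 1))" if "0 < s"
    proof -
      have "(s / t) powr ((?d + \<alpha>) / p) = s powr (q + \<alpha> / p) / t powr (q + \<alpha> / p)"
        using that t by (simp add: powr_divide q_def add_divide_distrib)
      moreover have "s powr (q - 1) = s powr (q + \<alpha> / p) * s powr (- (\<alpha> / p) - 1)"
        by (simp add: powr_add[symmetric])
      ultimately show ?thesis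
        using that t by simp
    qed
    then show "g s * ennreal (s powr (q - 1)) * indicator {0<..} s = ennreal (t powr (q + \<alpha> / p)) *
        (ennreal (1 - exp (- s)) * ennreal (s powr (- (\<alpha> / p) - 1)) * indicator {0<..} s)"
      by (cases "0 < s") (simp_all add: g_def ennreal_mult'[symmetric])
  qed
  also have "\<dots> = ennreal (t powr (q + \<alpha> / p)) * ennreal (Gamma (1 - \<alpha> / p) / (\<alpha> / p))"
    using p \<alpha> by (subst nn_integral_cmult) (auto simp: nn_integral_one_minus_exp_powr)
  also have "ennreal (unit_ball_vol ?d * q * t powr (- q)) * \<dots>
      = ennreal (unit_ball_vol ?d * q * t powr (- q) * (t powr (q + \<alpha> / p) * (Gamma (1 - \<alpha> / p) / (\<alpha> / p))))"
    using p \<alpha> by (simp add: ennreal_mult'[symmetric] q_def)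
  also have "unit_ball_vol ?d * q * t powr (- q) * (t powr (q + \<alpha> / p) * (Gamma (1 - \<alpha> / p) / (\<alpha> / p)))
      = unit_ball_vol ?d * ?d * Gamma (1 - \<alpha> / p) / \<alpha> * (t powr (- q) * t powr (q + \<alpha> / p))"
    using p \<alpha> by (simp add: q_def)
  also have "t powr (- q) * t powr (q + \<alpha> / p) = t powr (\<alpha> / p)"
    by (simp add: powr_add[symmetric])
  also have "unit_ball_vol ?d * ?d = 2 * pi powr (?d / 2) / Gamma (?d / 2)"
  proof -
    have "?d / 2 \<notin> \<int>\<^sub>\<le>\<^sub>0"
      using nonpos_Ints_nonpos[of "?d / 2"] by auto
    then have Gamma_Suc: "Gamma (?d / 2 + 1) = ?d / 2 * Gamma (?d / 2)"
      by (rule Gamma_plus1)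
    show ?thesis
      unfolding unit_ball_vol_def Gamma_Suc by simp
  qed
  finally show ?thesis
    by (simp add: field_simps)
qed

section \<open>The kernel and the solution\<close>

text \<open>
  In the radial variable \<open>\<bar>\<xi>\<bar>\<^sup>p\<close> this is the Gamma integral with parameter \<open>d / p\<close>.
\<close>

lemma integrable_exp_neg_norm_powr:
  assumes p: "0 < p"
  shows "integrable lborel (\<lambda>\<xi>::'a::euclidean_space. exp (- (norm \<xi> powr p)))"
proof (rule integrableI_bounded)
  define q where "q = real DIM('a) / p"
  have q: "0 < q"
    using p by (simp add: q_def)
  have "(\<integral>\<^sup>+\<xi>. ennreal (norm (exp (- (norm \<xi> powr p)))) \<partial>(lborel :: 'a measure))
      = (\<integral>\<^sup>+\<xi>. ennreal (exp (- (1 * norm \<xi> powr p))) \<partial>(lborel :: 'a measure))"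
    by simp
  also have "\<dots> = ennreal (unit_ball_vol (real DIM('a)) * q * 1 powr (- q)) *
      (\<integral>\<^sup>+s. ennreal (exp (- s)) * ennreal (s powr (q - 1)) * indicator {0<..} s \<partial>lborel)"
    using nn_integral_radial_powr[OF p zero_less_one, of "\<lambda>s. ennreal (exp (- s))", where 'a='a]
    by (simp add: q_def)
  also have "(\<integral>\<^sup>+s. ennreal (exp (- s)) * ennreal (s powr (q - 1)) * indicator {0<..} s \<partial>lborel)
      = (\<integral>\<^sup>+s. ennreal (indicator {0..} s * s powr (q - 1) / exp s) \<partial>lborel)"
    by (rule nn_integral_cong_AE, rule AE_mp[OF AE_lborel_singleton[of 0]], rule AE_I2)
       (auto simp: indicator_def ennreal_mult'[symmetric] exp_minus field_simps)
  also have "\<dots> = ennreal (Gamma q)"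
    using Gamma_conv_nn_integral_real[OF q] by simp
  finally show "(\<integral>\<^sup>+\<xi>. ennreal (norm (exp (- (norm \<xi> powr p)))) \<partial>(lborel :: 'a measure)) < \<infinity>"
    by (simp add: ennreal_mult_less_top)
qed measurable

text \<open>
  The function is integrable, so the Gaussian factor in the definition of \<^const>\<open>gauss_pos\<close> can be
  removed by letting its width tend to infinity.
\<close>

lemma fourier_integral_exp_neg_norm_powr_nonneg:
  fixes v :: "'a::euclidean_space"
  assumes p: "0 < p" "p \<le> 2"
  shows "(\<integral>\<xi>. exp (- (norm \<xi> powr p)) *\<^sub>R cis (v \<bullet> \<xi>) \<partial>lborel) \<in> \<real>\<^sub>\<ge>\<^sub>0"
proof -
  have "((norm \<xi>)\<^sup>2) powr (p / 2) = norm \<xi> powr p" for \<xi> :: 'a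
    by (cases "\<xi> = 0") (simp_all add: powr_realpow[symmetric] powr_powr del: powr_numeral)
  then have pd: "gauss_pos (\<lambda>\<xi>::'a. exp (- (norm \<xi> powr p)))"
    using gauss_pos_exp_neg_powr[of "p / 2", where 'a='a] p by simp
  show ?thesis
  proof (rule closed_sequentially[OF closed_nonneg_Reals_complex])
    show "(\<integral>\<xi>. (exp (- (norm \<xi> powr p)) * exp (- ((1 / real (Suc n)) / 2) * (norm \<xi>)\<^sup>2)) *\<^sub>R cis (v \<bullet> \<xi>) \<partial>lborel)
        \<in> \<real>\<^sub>\<ge>\<^sub>0" for n
      by (rule gauss_posD(3)[OF pd]) simp
    show "(\<lambda>n. \<integral>\<xi>. (exp (- (norm \<xi> powr p)) * exp (- ((1 / real (Suc n)) / 2) * (norm \<xi>)\<^sup>2)) *\<^sub>R cis (v \<bullet> \<xi>) \<partial>lborel)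
        \<longlonglongrightarrow> (\<integral>\<xi>. exp (- (norm \<xi> powr p)) *\<^sub>R cis (v \<bullet> \<xi>) \<partial>lborel)"
    proof (rule integral_dominated_convergence[OF _ _ integrable_exp_neg_norm_powr[OF p(1)]])
      show "AE \<xi> in lborel. norm ((exp (- (norm \<xi> powr p)) * exp (- ((1 / real (Suc n)) / 2) * (norm \<xi>)\<^sup>2)) *\<^sub>R cis (v \<bullet> \<xi>))
          \<le> exp (- (norm \<xi> powr p))" for n
        by (auto intro!: AE_I2 mult_left_le)
      show "AE \<xi> in lborel. (\<lambda>n. (exp (- (norm \<xi> powr p)) * exp (- ((1 / real (Suc n)) / 2) * (norm \<xi>)\<^sup>2)) *\<^sub>R cis (v \<bullet> \<xi>))
          \<longlonglongrightarrow> exp (- (norm \<xi> powr p)) *\<^sub>R cis (v \<bullet> \<xi>)"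
      proof (rule AE_I2)
        fix \<xi> :: 'a
        have "(\<lambda>n. (exp (- (norm \<xi> powr p)) * exp (- ((1 / real (Suc n)) / 2) * (norm \<xi>)\<^sup>2)) *\<^sub>R cis (v \<bullet> \<xi>))
            \<longlonglongrightarrow> (exp (- (norm \<xi> powr p)) * exp (- (0 / 2) * (norm \<xi>)\<^sup>2)) *\<^sub>R cis (v \<bullet> \<xi>)"
          using lim_inverse_n' LIMSEQ_Suc by (intro tendsto_intros) (blast, simp)
        then show "(\<lambda>n. (exp (- (norm \<xi> powr p)) * exp (- ((1 / real (Suc n)) / 2) * (norm \<xi>)\<^sup>2)) *\<^sub>R cis (v \<bullet> \<xi>))
            \<longlonglongrightarrow> exp (- (norm \<xi> powr p)) *\<^sub>R cis (v \<bullet> \<xi>)"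
          by simp
      qed
    qed measurable
  qed
qed

text \<open>
  The kernel with the character and the damping factor separated, the form in which
  Fourier inversion applies to it.
\<close>

lemma kernel_profile_eq:
  "kernel_profile p (v :: real ^ 'n) = (2 * pi) powr (- real DIM(real ^ 'n))
    * Re (\<integral>\<xi>. exp (- (norm \<xi> powr p)) *\<^sub>R cis (v \<bullet> \<xi>) \<partial>lborel)"
  unfolding kernel_profile_def
  by (simp add: exp_diff cis_conv_exp scaleR_conv_of_real exp_of_real[symmetric] exp_minus field_simps del: exp_of_real)

lemma kernel_profile_inversion:
  fixes \<eta> :: "real ^ 'n"
  assumes p: "0 < p" "p \<le> 2"
  shows "0 \<le> kernel_profile p (v :: real ^ 'n)"
    and "integrable lborel (kernel_profile p :: real ^ 'n \<Rightarrow> real)"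
    and "(\<integral>v. kernel_profile p v *\<^sub>R cis (- (\<eta> \<bullet> v)) \<partial>lborel) = of_real (exp (- (norm \<eta> powr p)))"
proof -
  note nonneg = fourier_integral_exp_neg_norm_powr_nonneg[OF p, where 'a="real ^ 'n"]
  show "0 \<le> kernel_profile p v"
    using nonneg[of v] unfolding kernel_profile_eq by (simp add: complex_nonneg_Reals_iff)
  have cont: "continuous_on UNIV (\<lambda>\<xi>::real ^ 'n. exp (- (norm \<xi> powr p)))"
    using p by (intro continuous_intros continuous_on_powr') auto
  have bnd: "\<bar>exp (- (norm \<xi> powr p))\<bar> \<le> 1" for \<xi> :: "real ^ 'n"
    by simp
  note inv = fourier_inversion_nonneg[OF integrable_exp_neg_norm_powr[OF p(1)] cont bnd nonneg]
  show "integrable lborel (kernel_profile p :: real ^ 'n \<Rightarrow> real)"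
    using inv(1) unfolding kernel_profile_eq[abs_def] .
  show "(\<integral>v. kernel_profile p v *\<^sub>R cis (- (\<eta> \<bullet> v)) \<partial>lborel) = of_real (exp (- (norm \<eta> powr p)))"
    using inv(2)[of \<eta>] unfolding kernel_profile_eq .
qed

text \<open>
  The substitution \<open>x = t powr (1 / p) v\<close> reduces everything to time one; the prefactor of the
  kernel cancels the Jacobian.
\<close>

lemma heat_kernel_inversion:
  fixes \<eta> :: "real ^ 'n"
  assumes p: "0 < p" "p \<le> 2" and t: "0 < t"
  shows "0 \<le> heat_kernel p (x :: real ^ 'n) t"
    and "integrable lborel (\<lambda>x :: real ^ 'n. heat_kernel p x t)"
    and "(\<integral>x. heat_kernel p x t *\<^sub>R cis (- (\<eta> \<bullet> x)) \<partial>lborel) = of_real (exp (- t * norm \<eta> powr p))"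
proof -
  note K = kernel_profile_inversion[OF p, where 'n='n]
  show "0 \<le> heat_kernel p x t"
    using K(1) by (simp add: heat_kernel_def)
  have [measurable]: "(kernel_profile p :: real ^ 'n \<Rightarrow> real) \<in> borel_measurable borel"
    using K(2) by auto
  have [measurable]: "(\<lambda>x :: real ^ 'n. heat_kernel p x t) \<in> borel_measurable borel"
    unfolding heat_kernel_def by measurable
  define c where "c = t powr (1 / p)"
  have c: "0 < c" "t powr (- 1 / p) = inverse c" "c powr p = t"
    using t p by (auto simp: c_def powr_minus[symmetric] powr_powr)
  have cd: "c ^ CARD('n) = t powr (real CARD('n) / p)"
    using t by (simp add: c_def powr_realpow[symmetric] powr_powr)
  have scale: "heat_kernel p (0 + c *\<^sub>R x) t = t powr (- real CARD('n) / p) * kernel_profile p x" for x :: "real ^ 'n"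
    using c by (simp add: heat_kernel_def)
  show "integrable lborel (\<lambda>x :: real ^ 'n. heat_kernel p x t)"
    using c K(2) by (subst lborel_affine_euclidean_integral(1)[where c=c and t=0, symmetric]) (auto simp: scale simp del: add_0)
  have "(\<integral>x. heat_kernel p x t *\<^sub>R cis (- (\<eta> \<bullet> x)) \<partial>lborel)
      = \<bar>c\<bar> ^ DIM(real ^ 'n) *\<^sub>R (\<integral>x. heat_kernel p (0 + c *\<^sub>R x) t *\<^sub>R cis (- (\<eta> \<bullet> (0 + c *\<^sub>R x))) \<partial>lborel)"
    using c by (intro lborel_affine_euclidean_integral(2)) auto
  also have "\<dots> = (c ^ CARD('n) * t powr (- real CARD('n) / p)) *\<^sub>R
      (\<integral>x. kernel_profile p x *\<^sub>R cis (- ((c *\<^sub>R \<eta>) \<bullet> x)) \<partial>lborel)"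
    unfolding scale using c by (simp add: scaleR_scaleR[symmetric] del: scaleR_scaleR)
  also have "\<dots> = of_real (exp (- t * norm \<eta> powr p))"
    unfolding K(3) using c t by (simp add: cd powr_add[symmetric] powr_mult)
  finally show "(\<integral>x. heat_kernel p x t *\<^sub>R cis (- (\<eta> \<bullet> x)) \<partial>lborel) = of_real (exp (- t * norm \<eta> powr p))" .
qed

lemma fourier_eq_cis: "fourier \<mu> \<xi> = (\<integral>v. cis (- (\<xi> \<bullet> v)) \<partial>\<mu>)"
  by (simp add: fourier_def cis_conv_exp)

text \<open>
  The convolution theorem for a measure and an integrable function. Nonnegativity of \<open>K\<close> ensures
  that the density is not truncated by the coercion to \<^typ>\<open>ennreal\<close>.
\<close>

lemma fourier_density_convolution:
  fixes K :: "real ^ 'n \<Rightarrow> real" and \<mu> :: "(real ^ 'n) measure"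
  assumes \<mu>: "\<mu> \<in> borel_probs" and K: "integrable lborel K" "\<And>x. 0 \<le> K x"
  shows "fourier (density lborel (\<lambda>x. ennreal (\<integral>y. K (x - y) \<partial>\<mu>))) \<xi>
    = (\<integral>x. K x *\<^sub>R cis (- (\<xi> \<bullet> x)) \<partial>lborel) * fourier \<mu> \<xi>"
proof -
  interpret prob_space \<mu>
    using \<mu> by (simp add: borel_probs_def)
  have [measurable_cong]: "sets \<mu> = sets borel"
    using \<mu> by (simp add: borel_probs_def)
  interpret P: pair_sigma_finite \<mu> lborel ..
  have [measurable]: "K \<in> borel_measurable borel"
    using K(1) by auto
  let ?f = "\<lambda>y x. K (x - y) *\<^sub>R cis (- (\<xi> \<bullet> x))"
  have fub: "integrable (\<mu> \<Otimes>\<^sub>M lborel) (case_prod ?f)"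
  proof (rule P.Fubini_integrable)
    have "(\<integral>x. norm (case_prod ?f (y, x)) \<partial>lborel) = (\<integral>x. K x \<partial>lborel)" for y
      using lborel_affine_euclidean_integral(2)[of 1 "\<lambda>x. K (x - y)" y] K(2) by simp
    then show "integrable \<mu> (\<lambda>y. \<integral>x. norm (case_prod ?f (y, x)) \<partial>lborel)"
      by simp
    show "AE y in \<mu>. integrable lborel (\<lambda>x. case_prod ?f (y, x))"
    proof (rule AE_I2, rule Bochner_Integration.integrable_bound)
      show "integrable lborel (\<lambda>x. K (x - y))" for y
        using lborel_affine_euclidean_integral(1)[of 1 "\<lambda>x. K (x - y)" y] K(1) by simp
    qed auto
  qed measurable
  have "fourier (density lborel (\<lambda>x. ennreal (\<integral>y. K (x - y) \<partial>\<mu>))) \<xi>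
      = (\<integral>x. (\<integral>y. K (x - y) \<partial>\<mu>) *\<^sub>R cis (- (\<xi> \<bullet> x)) \<partial>lborel)"
    unfolding fourier_eq_cis using K(2) by (subst integral_density) auto
  also have "\<dots> = (\<integral>x. (\<integral>y. ?f y x \<partial>\<mu>) \<partial>lborel)"
    by (intro Bochner_Integration.integral_cong refl)
       (simp add: scaleR_conv_of_real integral_complex_of_real[symmetric] del: integral_complex_of_real)
  also have "\<dots> = (\<integral>y. (\<integral>x. ?f y x \<partial>lborel) \<partial>\<mu>)"
    by (rule P.Fubini_integral[OF fub])
  also have "\<dots> = (\<integral>y. (\<integral>x. K x *\<^sub>R cis (- (\<xi> \<bullet> x)) \<partial>lborel) * cis (- (\<xi> \<bullet> y)) \<partial>\<mu>)"
  proof (intro Bochner_Integration.integral_cong refl)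
    fix y
    have "(\<integral>x. ?f y x \<partial>lborel) = (\<integral>x. ?f y (y + 1 *\<^sub>R x) \<partial>lborel)"
      by (subst lborel_affine_euclidean_integral(2)[of 1 _ y]) auto
    also have "\<dots> = (\<integral>x. (K x *\<^sub>R cis (- (\<xi> \<bullet> x))) * cis (- (\<xi> \<bullet> y)) \<partial>lborel)"
      by (simp add: cis_mult inner_add_right add.commute)
    finally show "(\<integral>x. ?f y x \<partial>lborel) = (\<integral>x. K x *\<^sub>R cis (- (\<xi> \<bullet> x)) \<partial>lborel) * cis (- (\<xi> \<bullet> y))"
      by (simp only: integral_mult_left_zero)
  qed
  finally show ?thesis
    unfolding fourier_eq_cis by simp
qed

lemma fourier_time_slice:
  fixes \<mu> :: "(real ^ 'n) measure"
  assumes p: "0 < p" "p \<le> 2" and t: "0 < t" and \<mu>: "\<mu> \<in> borel_probs"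
    and f: "\<And>x. f x t = cauchy_solution p \<mu> x t"
  shows "fourier (time_slice f \<mu> t) \<xi> = of_real (exp (- t * norm \<xi> powr p)) * fourier \<mu> \<xi>"
  using fourier_density_convolution[OF \<mu> heat_kernel_inversion(2,1)[OF p t], of \<xi>] heat_kernel_inversion(3)[OF p t, of \<xi>] t
  by (simp add: time_slice_def f cauchy_solution_def)

lemma cmod_fourier_le_sup_norm:
  assumes "\<mu> \<in> borel_probs"
  shows "cmod (fourier \<mu> \<xi>) \<le> sup_norm (fourier \<mu>)"
proof -
  interpret prob_space \<mu>
    using assms by (simp add: borel_probs_def)
  have "cmod (fourier \<mu> \<xi>) \<le> 1" for \<xi>
    using integral_norm_bound[of \<mu> "\<lambda>v. cis (- (\<xi> \<bullet> v))"] by (simp add: fourier_eq_cis prob_space)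
  then show ?thesis
    unfolding sup_norm_def by (intro cSUP_upper bdd_aboveI2) auto
qed

section \<open>The distance to the initial datum\<close>

theorem proposition10p3:
  fixes p \<alpha> :: real
    and \<mu> :: "(real ^ 'n) measure"
    and f :: "real ^ 'n \<Rightarrow> real \<Rightarrow> real"
  assumes "0 < p" and "p \<le> 2"
    and "0 < \<alpha>"
    and "p < 2 \<Longrightarrow> \<alpha> < min 1 p"
    and "p = 2 \<Longrightarrow> \<alpha> < 1"
    and "\<mu> \<in> borel_probs_moment \<alpha>"
    and "\<And>x t. t > 0 \<Longrightarrow> f x t = cauchy_solution p \<mu> x t"
  shows "(\<forall>t\<ge>0. rho \<alpha> (time_slice f \<mu> t) \<mu>
            \<le> ennreal (2 * pi powr (real CARD('n) / 2) * Gamma (1 - \<alpha> / p)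
                         / (\<alpha> * Gamma (real CARD('n) / 2))
                       * t powr (\<alpha> / p) * sup_norm (fourier \<mu>)))
       \<and> ((\<lambda>t. rho \<alpha> (time_slice f \<mu> t) \<mu>) \<longlongrightarrow> 0) (at_right 0)"
proof -
  let ?S = "sup_norm (fourier \<mu>)"
  let ?C = "2 * pi powr (real CARD('n) / 2) * Gamma (1 - \<alpha> / p) / (\<alpha> * Gamma (real CARD('n) / 2))"
  have p: "0 < p" "p \<le> 2"
    by fact+
  have \<alpha>: "0 < \<alpha>" "\<alpha> < p"
    using assms(3-5) p by (cases "p = 2"; simp)+
  have \<mu>: "\<mu> \<in> borel_probs"
    using assms(6) by (simp add: borel_probs_moment_def)
  note S = cmod_fourier_le_sup_norm[OF \<mu>]
  have S0: "0 \<le> ?S"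
    using S[of 0] norm_ge_zero order_trans by blast
  have bound: "rho \<alpha> (time_slice f \<mu> t) \<mu> \<le> ennreal (?C * t powr (\<alpha> / p) * ?S)" if t: "0 \<le> t" for t
  proof (cases "t = 0")
    case True
    then show ?thesis
      by (simp add: rho_def time_slice_def)
  next
    case False
    with t have t: "0 < t"
      by simp
    have "rho \<alpha> (time_slice f \<mu> t) \<mu> \<le> (\<integral>\<^sup>+\<xi>. ennreal ((1 - exp (- t * norm \<xi> powr p))
        / norm \<xi> powr (real DIM(real ^ 'n) + \<alpha>)) * ennreal ?S \<partial>(lborel :: (real ^ 'n) measure))"
      unfolding rho_def
    proof (intro nn_integral_mono)
      fix \<xi> :: "real ^ 'n"
      have e: "exp (- t * norm \<xi> powr p) \<le> 1"
        using t by simp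
      have "fourier (time_slice f \<mu> t) \<xi> - fourier \<mu> \<xi> = of_real (exp (- t * norm \<xi> powr p) - 1) * fourier \<mu> \<xi>"
        using fourier_time_slice[OF p t \<mu>, of f \<xi>] assms(7)[OF t] by (simp add: algebra_simps)
      then have "cmod (fourier (time_slice f \<mu> t) \<xi> - fourier \<mu> \<xi>) = (1 - exp (- t * norm \<xi> powr p)) * cmod (fourier \<mu> \<xi>)"
        using e by (simp only: norm_mult norm_of_real abs_minus_commute[of _ 1] abs_of_nonneg[OF diff_ge_0_iff_ge[THEN iffD2]])
      also have "\<dots> \<le> (1 - exp (- t * norm \<xi> powr p)) * ?S"
        using e S by (intro mult_left_mono) auto
      finally show "ennreal (cmod (fourier (time_slice f \<mu> t) \<xi> - fourier \<mu> \<xi>) / norm \<xi> powr (real CARD('n) + \<alpha>))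
          \<le> ennreal ((1 - exp (- t * norm \<xi> powr p)) / norm \<xi> powr (real DIM(real ^ 'n) + \<alpha>)) * ennreal ?S"
        using S0 by (simp add: ennreal_mult''[symmetric] divide_right_mono ennreal_leI)
    qed
    also have "\<dots> = ennreal (?C * t powr (\<alpha> / p)) * ennreal ?S"
      using nn_integral_damping_defect[OF p(1) t \<alpha>, where 'a="real ^ 'n"] by (subst nn_integral_multc) auto
    also have "\<dots> = ennreal (?C * t powr (\<alpha> / p) * ?S)"
      by (rule ennreal_mult''[OF S0, symmetric])
    finally show ?thesis .
  qed
  moreover have "((\<lambda>t. rho \<alpha> (time_slice f \<mu> t) \<mu>) \<longlongrightarrow> 0) (at_right 0)"
  proof (rule tendsto_sandwich[OF _ _ tendsto_const])
    show "\<forall>\<^sub>F t in at_right 0. rho \<alpha> (time_slice f \<mu> t) \<mu> \<le> ennreal (?C * t powr (\<alpha> / p) * ?S)"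
      using bound by (auto simp: eventually_at_right_less intro: eventually_mono[OF eventually_at_right_less])
    have "((\<lambda>t. t powr (\<alpha> / p)) \<longlongrightarrow> 0 powr (\<alpha> / p)) (at_right 0)"
      using \<alpha> p by (intro tendsto_powr' tendsto_ident_at tendsto_const)
        (auto intro: eventually_mono[OF eventually_at_right_less])
    then have "((\<lambda>t. ?C * t powr (\<alpha> / p) * ?S) \<longlongrightarrow> ?C * 0 * ?S) (at_right 0)"
      by (intro tendsto_intros) simp
    then show "((\<lambda>t. ennreal (?C * t powr (\<alpha> / p) * ?S)) \<longlongrightarrow> 0) (at_right 0)"
      using tendsto_ennrealI by fastforce
  qed simp
  ultimately show ?thesis
    by blast
qed

end
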